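(* Let $c\ge 0$. For $p>0$ and integers $n>p$, let $A_n$ be the adjacency matrix of a random graph following $\mathrm{G}(n,p/n)$, and let $K_n=D_n^{-1}A_n$, where $D_n$ is the diagonal matrix whose $i$-th diagonal entry is $c+\sum_{j=1}^n(A_n)_{ij}$ if the $i$-th row of $A_n$ is not identically $0$, and is $1$ if the entire $i$-th row of $A_n$ is $0$. Let $\mu_\infty$ be the limiting distribution, as $n\to\infty$, of the empirical spectral distribution $\mu_{K_n}$ (weak convergence in probability). Then for any $p>0$, $$\operatorname{ess\,sup}\mu_\infty=\tau_c.$$
   Context: $\mathrm{G}(n,a)$, for $a\in[0,1]$, denotes the Erdős–Rényi distribution on simple graphs with vertex set $\{1,\dots,n\}$ in which each pair of distinct vertices is joined by an edge with probability $a$, independently of the other pairs. The adjacency matrix has $(i,j)$ entry $1$ if $\{i,j\}$ is an edge and $0$ otherwise. For an $n\times n$ matrix $M$ with eigenvalues $\lambda_1(M),\dots,\lambda_n(M)$ (counted with multiplicity), $\mu_M=n^{-1}\sum_{i=1}^n\delta_{\lambda_i(M)}$; the eigenvalues of $K_n$ are real. It is known that $\mu_{K_n}$ converges weakly in probability to a nonrandom probability measure $\mu_\infty$ (depending on $c$ and $p$), whose $k$-th moment, for each integer $k\ge1$, is $\mathrm{E}\,r_k(T,\emptyset,c)$, where $T$ is a Galton–Watson tree rooted at $\emptyset$ with Poisson offspring distribution of mean $p$, and $r_k$ is defined as follows. For a (locally finite, simple) graph $G$ with vertex $v_0$, consider a random walk on $G$ from $v_0$ at step $0$: if $v_0$ has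 degree at least $1$, then whenever the walk is alive at a vertex $v$ of degree $d$, at the next step it moves to each given neighbor of $v$ with probability $1/(c+d)$, or is killed with probability $c/(c+d)$; if $v_0$ has degree $0$, the walk is killed at step $1$. Then $r_k(G,v_0,c)$ is the probability that the walk is alive and at $v_0$ at step $k$. For a measure $\nu$ on $\mathbb{R}$, $\operatorname{ess\,sup}\nu=\sup\{x:\nu(x,\infty)>0\}$. For $c\ge0$, $\tau_c=1/\sqrt{1+c}$. *)

theory Defs
  imports
    "HOL-Probability.Probability"
    "HOL-Computational_Algebra.Fundamental_Theorem_Algebra"
    "Jordan_Normal_Form.Char_Poly"
    "Jordan_Normal_Form.Gauss_Jordan_Elimination"
begin

unbundle no vec_syntax

text \<open>
  A simple graph on \<open>{1..n}\<close> is represented by its set of edges, an edge being a two-element set of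
  vertices. For \<open>a\<close> outside \<open>[0,1]\<close> the parameter is clamped by \<open>bernoulli_pmf\<close>; such values occur
  below only for \<open>n < p\<close>, which is irrelevant for the limit.
\<close>

definition vertex_pairs :: "nat \<Rightarrow> nat set set" where
  "vertex_pairs n = {e. e \<subseteq> {1..n} \<and> card e = 2}"

definition erdos_renyi :: "nat \<Rightarrow> real \<Rightarrow> nat set set pmf" where
  "erdos_renyi n a =
     map_pmf (\<lambda>\<omega>. {e \<in> vertex_pairs n. \<omega> e})
       (Pi_pmf (vertex_pairs n) False (\<lambda>_. bernoulli_pmf a))"

text \<open>Matrix indices start at 0, so the row and column of vertex \<open>v\<close> have index \<open>v - 1\<close>.\<close>

definition adjacency_mat :: "nat \<Rightarrow> nat set set \<Rightarrow> real mat" where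
  "adjacency_mat n E = mat n n (\<lambda>(i, j). if {Suc i, Suc j} \<in> E then 1 else 0)"

definition deg_mat :: "real \<Rightarrow> nat \<Rightarrow> real mat \<Rightarrow> real mat" where
  "deg_mat c n A = mat n n (\<lambda>(i, j).
     if i = j then (if row A i = 0\<^sub>v n then 1 else c + (\<Sum>k<n. A $$ (i, k))) else 0)"

text \<open>Lemma \<open>walk_mat_eq\<close> below shows that \<open>deg_mat\<close> is invertible, so \<open>the\<close> is harmless here.\<close>

definition walk_mat :: "real \<Rightarrow> nat \<Rightarrow> nat set set \<Rightarrow> real mat" where
  "walk_mat c n E = the (mat_inverse (deg_mat c n (adjacency_mat n E))) * adjacency_mat n E"

text \<open>
  The empirical spectral distribution. \<open>proots\<close> counts the real roots of the characteristic polynomial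
  with multiplicity; for \<open>walk_mat\<close> there are exactly \<open>n\<close> of them, by \<open>size_eigenvalues_walk_mat\<close>.
\<close>

definition esd :: "real mat \<Rightarrow> real measure" where
  "esd M = measure_pmf (pmf_of_multiset (proots (char_poly M)))"

text \<open>
  Weak convergence in probability of random measures \<open>X n\<close>, defined on probability spaces \<open>\<Omega> n\<close>, to a
  nonrandom measure: integrals of bounded continuous functions converge in probability.
\<close>

definition weak_conv_in_prob ::
    "(nat \<Rightarrow> 'a measure) \<Rightarrow> (nat \<Rightarrow> 'a \<Rightarrow> real measure) \<Rightarrow> real measure \<Rightarrow> bool" where
  "weak_conv_in_prob \<Omega> X \<mu> \<longleftrightarrow>
     (\<forall>f :: real \<Rightarrow> real. continuous_on UNIV f \<longrightarrow> bounded (range f) \<longrightarrow>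
       (\<forall>\<epsilon>>0. (\<lambda>n. measure (\<Omega> n)
          {\<omega> \<in> space (\<Omega> n). \<bar>(\<integral>x. f x \<partial>X n \<omega>) - (\<integral>x. f x \<partial>\<mu>)\<bar> > \<epsilon>}) \<longlonglongrightarrow> 0))"

text \<open>Extended-real valued, so that measures with unbounded support have essential supremum \<open>\<infinity>\<close>.\<close>

definition ess_sup :: "real measure \<Rightarrow> ereal" where
  "ess_sup \<nu> = Sup {ereal x |x. emeasure \<nu> {x<..} > 0}"

definition tau :: "real \<Rightarrow> real" where
  "tau c = 1 / sqrt (1 + c)"

text \<open>Well-definedness of \<open>walk_mat\<close> and reality of its spectrum.\<close>

definition deg_entry :: "real \<Rightarrow> nat \<Rightarrow> nat set set \<Rightarrow> nat \<Rightarrow> real" where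
  "deg_entry c n E i = deg_mat c n (adjacency_mat n E) $$ (i, i)"

lemma deg_entry_pos:
  assumes "c \<ge> 0" "i < n"
  shows "deg_entry c n E i > 0"
proof (cases "row (adjacency_mat n E) i = 0\<^sub>v n")
  case True
  then show ?thesis using assms by (simp add: deg_entry_def deg_mat_def)
next
  case False
  have nn: "adjacency_mat n E $$ (i, k) \<ge> 0" if "k < n" for k
    using assms that by (simp add: adjacency_mat_def)
  from False obtain k where k: "k < n" "adjacency_mat n E $$ (i, k) \<noteq> 0"
    using assms(2) by (auto simp: adjacency_mat_def vec_eq_iff)
  have "(\<Sum>k<n. adjacency_mat n E $$ (i, k)) > 0"
    by (rule sum_pos2[of _ k]) (use k nn in \<open>force simp: less_le\<close>)+
  then show ?thesis using False assms by (simp add: deg_entry_def deg_mat_def)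
qed

lemma walk_mat_eq:
  assumes "c \<ge> 0"
  shows "mat_inverse (deg_mat c n (adjacency_mat n E)) \<noteq> None"
    and "walk_mat c n E = mat n n (\<lambda>(i, j). adjacency_mat n E $$ (i, j) / deg_entry c n E i)"
proof -
  let ?D = "deg_mat c n (adjacency_mat n E)" and ?d = "deg_entry c n E"
  let ?B = "mat n n (\<lambda>(i, j). if i = j then 1 / ?d i else 0) :: real mat"
  have D: "?D \<in> carrier_mat n n" by (simp add: deg_mat_def)
  have D_eq: "?D = mat n n (\<lambda>(i, j). if i = j then ?d i else 0)"
    by (rule eq_matI) (auto simp: deg_entry_def deg_mat_def)
  have nz: "?d i \<noteq> 0" if "i < n" for i
    using deg_entry_pos[OF assms that, of E] by simp
  have DB: "?D * ?B = 1\<^sub>m n" and BD: "?B * ?D = 1\<^sub>m n"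
    unfolding D_eq using nz
    by (auto simp: mat_eq_iff scalar_prod_def if_distrib[of "\<lambda>x. _ * x"] if_distribR[of _ "(*)"]
        cong: if_cong)
  have BC: "?B \<in> carrier_mat n n" by simp
  show inv: "mat_inverse ?D \<noteq> None"
  proof
    assume "mat_inverse ?D = None"
    from mat_inverse(1)[OF D this, of undefined] show False
      using D BC DB BD by (auto simp: Units_def ring_mat_def)
  qed
  then obtain B' where B': "mat_inverse ?D = Some B'" by auto
  note * = mat_inverse(2)[OF D B']
  have "B' = B' * (?D * ?B)" using * DB right_mult_one_mat[of B' n n] by simp
  also have "\<dots> = (B' * ?D) * ?B"
    using * D BC by (intro assoc_mult_mat[symmetric, of _ n n _ n _ n]) auto
  also have "\<dots> = ?B" using * left_mult_one_mat[OF BC] by simp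
  finally have B'_eq: "B' = ?B" .
  show "walk_mat c n E = mat n n (\<lambda>(i, j). adjacency_mat n E $$ (i, j) / ?d i)"
    unfolding walk_mat_def B' option.sel B'_eq
    by (rule eq_matI)
      (auto simp: adjacency_mat_def scalar_prod_def mult_delta_left cong: if_cong)
qed

lemma size_proots_real_rooted:
  fixes q :: "real poly"
  assumes "q \<noteq> 0" and "\<And>z. poly (map_poly complex_of_real q) z = 0 \<Longrightarrow> z \<in> \<real>"
  shows "size (proots q) = degree q"
  using assms
proof (induction "degree q" arbitrary: q)
  case 0
  then obtain a where "q = [:a:]" by (auto elim: degree_eq_zeroE)
  then show ?case by simp
next
  case (Suc m)
  interpret h: map_poly_comm_ring_hom complex_of_real ..
  have "degree (map_poly complex_of_real q) = Suc m"
    using Suc by (simp add: degree_map_poly)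
  then obtain z where z: "poly (map_poly complex_of_real q) z = 0"
    using fundamental_theorem_of_algebra[of "map_poly complex_of_real q"]
    by (auto simp: constant_degree)
  with Suc.prems obtain x where "z = of_real x" by (metis Reals_cases)
  with z have "poly q x = 0" by simp
  then obtain r where r: "q = [:-x, 1:] * r" by (metis dvdE poly_eq_0_iff_dvd)
  with Suc.prems have r0: "r \<noteq> 0" by auto
  have deg: "degree q = Suc (degree r)" unfolding r using r0 by (subst degree_mult_eq) auto
  have "size (proots r) = degree r"
  proof (rule Suc.hyps)
    show "m = degree r" using deg Suc.hyps by simp
    show "z \<in> \<real>" if "poly (map_poly complex_of_real r) z = 0" for z
    proof (rule Suc.prems(2))
      have "map_poly complex_of_real q = map_poly of_real [:-x, 1:] * map_poly of_real r"
        unfolding r by (rule h.hom_mult)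
      then show "poly (map_poly complex_of_real q) z = 0" using that by simp
    qed
  qed (fact r0)
  then show ?case using deg r0 unfolding r by (subst proots_mult) auto
qed

lemma eigenvalue_walk_mat_real:
  assumes "c \<ge> 0" and "eigenvalue (map_mat complex_of_real (walk_mat c n E)) z"
  shows "z \<in> \<real>"
proof -
  let ?d = "deg_entry c n E" and ?a = "\<lambda>i j. adjacency_mat n E $$ (i, j)"
  obtain v where v: "v \<in> carrier_vec n" "v \<noteq> 0\<^sub>v n"
      and ev: "map_mat complex_of_real (walk_mat c n E) *\<^sub>v v = z \<cdot>\<^sub>v v"
    using assms(2) unfolding eigenvalue_def eigenvector_def by (auto simp: walk_mat_eq[OF assms(1)])
  have row: "(\<Sum>j<n. of_real (?a i j) * v $ j) = z * of_real (?d i) * v $ i" if "i < n" for i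
  proof -
    have "(\<Sum>j<n. of_real (?a i j / ?d i) * v $ j) = z * v $ i"
      using arg_cong[OF ev, of "\<lambda>w. w $ i"] that v(1)
      by (simp add: walk_mat_eq[OF assms(1)] scalar_prod_def lessThan_atLeast0)
    moreover have "?d i \<noteq> 0" using deg_entry_pos[OF assms(1) that, of E] by simp
    ultimately show ?thesis
      by (simp add: sum_divide_distrib[symmetric] field_simps)
  qed
  define S where "S = (\<Sum>i<n. ?d i * (norm (v $ i))\<^sup>2)"
  define Q where "Q = (\<Sum>i<n. \<Sum>j<n. cnj (v $ i) * (of_real (?a i j) * v $ j))"
  have sym: "?a i j = ?a j i" if "i < n" "j < n" for i j
    using that by (simp add: adjacency_mat_def insert_commute)
  have "cnj Q = (\<Sum>i<n. \<Sum>j<n. cnj (v $ j) * (of_real (?a j i) * v $ i))"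
    unfolding Q_def using sym by (auto intro!: sum.cong simp: mult_ac)
  also have "\<dots> = Q" unfolding Q_def by (rule sum.swap)
  finally have Qr: "Q \<in> \<real>" by (simp add: Reals_cnj_iff)
  have "Q = (\<Sum>i<n. cnj (v $ i) * (z * of_real (?d i) * v $ i))"
    unfolding Q_def using row by (auto simp: sum_distrib_left[symmetric])
  also have "\<dots> = z * of_real S"
    unfolding S_def of_real_sum sum_distrib_left
    by (intro sum.cong refl) (simp add: complex_norm_square mult_ac del: of_real_power)
  finally have Q: "Q = z * of_real S" .
  obtain i where i: "i < n" "v $ i \<noteq> 0" using v by (auto simp: vec_eq_iff)
  have "S > 0" unfolding S_def
    by (rule sum_pos2[of _ i])
      (use i deg_entry_pos[OF assms(1)] in \<open>auto intro!: mult_nonneg_nonneg simp: less_imp_le\<close>)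
  then have "z = Q / of_real S" using Q by simp
  then show ?thesis using Qr by (simp add: Reals_divide)
qed

lemma size_eigenvalues_walk_mat:
  assumes "c \<ge> 0"
  shows "size (proots (char_poly (walk_mat c n E))) = n"
proof -
  let ?K = "walk_mat c n E"
  have K: "?K \<in> carrier_mat n n" by (simp add: walk_mat_eq[OF assms])
  note dm = degree_monic_char_poly[OF K]
  have "size (proots (char_poly ?K)) = degree (char_poly ?K)"
  proof (rule size_proots_real_rooted)
    show "char_poly ?K \<noteq> 0" using dm by auto
    fix z assume "poly (map_poly complex_of_real (char_poly ?K)) z = 0"
    then have "eigenvalue (map_mat complex_of_real ?K) z"
      using K by (subst eigenvalue_root_char_poly[of _ n]) (simp_all add: of_real_hom.char_poly_hom[OF K])
    then show "z \<in> \<real>" using assms by (rule eigenvalue_walk_mat_real[rotated])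
  qed
  then show ?thesis using dm by simp
qed

end

theory Submission
  imports Defs "Jordan_Normal_Form.Schur_Decomposition" "HOL-Real_Asymp.Real_Asymp"
begin

text \<open>
  Everything is tested against \<open>(1 + x)\<^sup>k\<close>, whose integral against \<open>\<mu>\<^bsub>K\<^esub>\<close> is the average over \<open>v\<close> of
  the diagonal entries of \<open>(I + K)\<^sup>k\<close>. Unlike \<open>x\<^sup>k\<close>, it singles out the right end of the spectrum. As
  only bounded functionals occur, convergence in probability can be replaced by convergence of
  expectations.

  Upper bound: if the ball around \<open>v\<close> is a tree, then \<open>f w = \<tau>\<^sub>c ^ dist v w\<close> satisfies
  \<open>K f \<le> \<tau>\<^sub>c f\<close> there, so the \<open>(v, v)\<close> entry of \<open>(I + K)\<^sup>k\<close> is at most \<open>(1 + \<tau>\<^sub>c)\<^sup>k\<close>. The ball fails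
  to be a tree with probability \<open>O(1/n)\<close>.

  Lower bound: with probability bounded below, \<open>v\<close> is the centre of a component that is a star with \<open>m\<close>
  leaves. Then \<open>\<plusminus>\<lambda>\<close> with \<open>\<lambda>\<^sup>2 = m / ((c + m) (1 + c))\<close> are eigenvalues, the \<open>(v, v)\<close> entry is at
  least \<open>(1 + \<lambda>)\<^sup>k / 2\<close>, and \<open>\<lambda> \<rightarrow> \<tau>\<^sub>c\<close> as \<open>m \<rightarrow> \<infinity>\<close>.
\<close>

subsection \<open>Lazy walks on locally tree-like graphs\<close>

definition nbrs :: "'a set set \<Rightarrow> 'a \<Rightarrow> 'a set" where
  "nbrs E v = {w. {v, w} \<in> E}"

text \<open>For unreachable \<open>w\<close> the \<open>LEAST\<close> ranges over an empty set and
  its value is unspecified; hence facts about distances below assume \<open>reach\<close> or a given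
  walk.\<close>

definition gdist :: "'a set set \<Rightarrow> 'a \<Rightarrow> 'a \<Rightarrow> nat" where
  "gdist E v w = (LEAST m. (v, w) \<in> {(x, y). {x, y} \<in> E} ^^ m)"

definition reach :: "'a set set \<Rightarrow> 'a \<Rightarrow> 'a \<Rightarrow> bool" where
  "reach E v w \<longleftrightarrow> (\<exists>m. (v, w) \<in> {(x, y). {x, y} \<in> E} ^^ m)"

text \<open>A connected set spanning fewer edges than vertices is a tree, so this is a local tree
  condition. Counting edges instead of excluding cycles makes its failure a union of events of the
  form "m given pairs inside m vertices are edges", which suits a first-moment bound.\<close>

definition sparse_at :: "nat \<Rightarrow> 'a set set \<Rightarrow> 'a \<Rightarrow> bool" where
  "sparse_at L E v \<longleftrightarrow>
     (\<forall>W. finite W \<longrightarrow> v \<in> W \<longrightarrow> card W \<le> L \<longrightarrow> card {e \<in> E. e \<subseteq> W} < card W)"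

text \<open>The operator I + K on functions of vertices. At an isolated vertex the sum is empty and
  the fraction vanishes, even for \<open>c = 0\<close>; this agrees with the zero row of
  \<open>walk_mat\<close>.\<close>

definition lazy_step :: "real \<Rightarrow> 'a set set \<Rightarrow> ('a \<Rightarrow> real) \<Rightarrow> 'a \<Rightarrow> real" where
  "lazy_step c E g v = g v + (\<Sum>w\<in>nbrs E v. g w) / (c + real (card (nbrs E v)))"

section \<open>Graph distance and parents on shortest paths\<close>

lemma nbrs_sym: "w \<in> nbrs E v \<longleftrightarrow> v \<in> nbrs E w"
  by (simp add: nbrs_def insert_commute)

lemma gdist_relpow:
  assumes "reach E v w"
  shows "(v, w) \<in> {(x, y). {x, y} \<in> E} ^^ gdist E v w"
  using assms unfolding gdist_def reach_def by (auto intro: LeastI)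

lemma gdist_le: "(v, w) \<in> {(x, y). {x, y} \<in> E} ^^ m \<Longrightarrow> gdist E v w \<le> m"
  unfolding gdist_def by (rule Least_le)

lemma reach_refl: "reach E v v"
  unfolding reach_def by (rule exI[of _ 0]) simp

lemma gdist_refl [simp]: "gdist E v v = 0"
  using gdist_le[where v = v and w = v and E = E and m = 0] by simp

lemma gdist_eq_0: "reach E v w \<Longrightarrow> gdist E v w = 0 \<longleftrightarrow> w = v"
  using gdist_relpow[of E v w] by (auto split: if_splits)

lemma reach_nbr:
  assumes "reach E v w" "x \<in> nbrs E w"
  shows "reach E v x" and "gdist E v x \<le> Suc (gdist E v w)"
proof -
  have "(v, x) \<in> {(x, y). {x, y} \<in> E} ^^ Suc (gdist E v w)"
    using gdist_relpow[OF assms(1)] assms(2) by (auto simp: nbrs_def)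
  then show "gdist E v x \<le> Suc (gdist E v w)"
    by (rule gdist_le)
  from \<open>(v, x) \<in> _\<close> show "reach E v x"
    unfolding reach_def by (rule exI)
qed

lemma gdist_parent:
  assumes "reach E v w" "w \<noteq> v"
  shows "\<exists>u. u \<in> nbrs E w \<and> reach E v u \<and> gdist E v u < gdist E v w"
proof -
  have "gdist E v w \<noteq> 0" using gdist_eq_0 assms by metis
  then obtain m where m: "gdist E v w = Suc m" by (cases "gdist E v w") auto
  with gdist_relpow[OF assms(1)] obtain u
    where u: "(v, u) \<in> {(x, y). {x, y} \<in> E} ^^ m" "{u, w} \<in> E" by auto
  then have "gdist E v u \<le> m" "reach E v u"
    by (auto intro: gdist_le simp: reach_def)
  then show ?thesis using u m by (auto simp: nbrs_def insert_commute)
qed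

text \<open>The set is the chain \<open>y\<close>, \<open>par y\<close>, \<open>par (par y)\<close>,
  ... down to \<open>v\<close>. Distances drop strictly along it, which bounds its size and makes
  the induction terminate.\<close>

lemma parent_closed_set:
  assumes par: "\<And>u. reach E v u \<Longrightarrow> u \<noteq> v \<Longrightarrow> reach E v (par u) \<and> gdist E v (par u) < gdist E v u"
    and "reach E v y"
  shows "\<exists>P. finite P \<and> v \<in> P \<and> y \<in> P \<and> card P \<le> Suc (gdist E v y) \<and>
     (\<forall>u\<in>P. reach E v u) \<and> (\<forall>u\<in>P - {v}. par u \<in> P)"
  using assms(2)
proof (induction "gdist E v y" arbitrary: y rule: less_induct)
  case less
  show ?case
  proof (cases "y = v")
    case True
    then show ?thesis by (intro exI[of _ "{v}"]) (auto simp: reach_refl)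
  next
    case False
    from par[OF less.prems False] less.hyps obtain P where
      "finite P" "v \<in> P" "par y \<in> P" "card P \<le> Suc (gdist E v (par y))"
      "\<forall>u\<in>P. reach E v u" "\<forall>u\<in>P - {v}. par u \<in> P" by blast
    then show ?thesis using par[OF less.prems False] less.prems
      by (intro exI[of _ "insert y P"]) (auto simp: card_insert_if)
  qed
qed

text \<open>Following parents from \<open>y\<close> and \<open>z\<close> back to \<open>v\<close> and adding \<open>w\<close> gives a set \<open>W\<close> in which every
  vertex other than \<open>v\<close> and \<open>w\<close> is charged with the edge to its parent, while \<open>w\<close> has two further edges.\<close>

lemma sparse_at_unique_parent:
  assumes sp: "sparse_at (2 * k + 3) E v" and E2: "\<And>e. e \<in> E \<Longrightarrow> card e = 2"
    and w: "reach E v w" "gdist E v w \<le> k"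
    and y: "y \<in> nbrs E w" "gdist E v y \<le> gdist E v w"
    and z: "z \<in> nbrs E w" "gdist E v z \<le> gdist E v w"
  shows "y = z"
proof (rule ccontr)
  assume "y \<noteq> z"
  have ry: "reach E v y" and rz: "reach E v z" using reach_nbr[OF w(1)] y z by auto
  have wv: "w \<noteq> v"
  proof
    assume "w = v"
    then have "y = v" "z = v" using gdist_eq_0[OF ry] gdist_eq_0[OF rz] y z by auto
    with \<open>y \<noteq> z\<close> show False by simp
  qed
  define par where "par u = (SOME x. x \<in> nbrs E u \<and> reach E v x \<and> gdist E v x < gdist E v u)" for u
  have par: "par u \<in> nbrs E u \<and> reach E v (par u) \<and> gdist E v (par u) < gdist E v u"
    if "reach E v u" "u \<noteq> v" for u
    unfolding par_def by (rule someI_ex) (rule gdist_parent[OF that])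
  obtain P where P: "finite P" "v \<in> P" "y \<in> P" "card P \<le> Suc (gdist E v y)"
      "\<forall>u\<in>P. reach E v u" "\<forall>u\<in>P - {v}. par u \<in> P"
    using parent_closed_set[of E v par y] par ry by blast
  obtain Q where Q: "finite Q" "v \<in> Q" "z \<in> Q" "card Q \<le> Suc (gdist E v z)"
      "\<forall>u\<in>Q. reach E v u" "\<forall>u\<in>Q - {v}. par u \<in> Q"
    using parent_closed_set[of E v par z] par rz by blast
  define W where "W = insert w (P \<union> Q)"
  have finW: "finite W" and vW: "v \<in> W" using P Q by (auto simp: W_def)
  have "card W \<le> Suc (card (P \<union> Q))" unfolding W_def using P Q by (simp add: card_insert_if)
  also have "\<dots> \<le> Suc (card P + card Q)" using card_Un_le by auto
  \<comment> \<open>Both chains have at most k + 1 vertices, since \<open>y\<close> and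
    \<open>z\<close> are no farther from \<open>v\<close> than \<open>w\<close>, and
    \<open>w\<close> adds one more. This fixes the size bound in \<open>sparse_at\<close>.\<close>
  also have "\<dots> \<le> 2 * k + 3" using P Q y z w by linarith
  finally have lt: "card {e \<in> E. e \<subseteq> W} < card W"
    using sp finW vW unfolding sparse_at_def by blast
  let ?F = "(\<lambda>u. {u, par u}) ` (W - {v, w})"
  have rW: "reach E v u" if "u \<in> W" for u using that P Q w by (auto simp: W_def)
  \<comment> \<open>Two vertices charged with the same edge would be parents of each other, each
    strictly closer to \<open>v\<close> than the other.\<close>
  have inj: "inj_on (\<lambda>u. {u, par u}) (W - {v, w})"
  proof (rule inj_onI)
    fix a b assume ab: "a \<in> W - {v, w}" "b \<in> W - {v, w}" "{a, par a} = {b, par b}"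
    show "a = b"
    proof (rule ccontr)
      assume "a \<noteq> b"
      then have "a = par b" "b = par a" using ab(3) by (auto simp: doubleton_eq_iff)
      moreover have "gdist E v (par a) < gdist E v a" "gdist E v (par b) < gdist E v b"
        using par rW ab by auto
      ultimately show False by simp
    qed
  qed
  \<comment> \<open>An edge from \<open>w\<close> to \<open>x\<close> can be charged to a vertex
    other than \<open>w\<close> only if \<open>w\<close> is the parent of \<open>x\<close>, which
    would put \<open>x\<close> farther from \<open>v\<close> than \<open>w\<close>.\<close>
  have new: "{w, x} \<notin> ?F" if "gdist E v x \<le> gdist E v w" for x
  proof
    assume "{w, x} \<in> ?F"
    then obtain u where u: "u \<in> W" "u \<noteq> v" "u \<noteq> w" "{w, x} = {u, par u}" by auto
    then have "u = x" "par u = w" by (auto simp: doubleton_eq_iff)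
    then show False using par[OF rW u(2)] u that by auto
  qed
  have "{w, y} \<noteq> {w, z}" using \<open>y \<noteq> z\<close> by (auto simp: doubleton_eq_iff)
  then have "card (insert {w, y} (insert {w, z} ?F)) = card ?F + 2"
    using new[OF y(2)] new[OF z(2)] finW by (simp add: card_insert_if)
  also have "card ?F + 2 = card W"
  proof -
    have "card ({v, w}) = 2" using wv by simp
    moreover have "card ({v, w}) \<le> card W" using finW vW by (intro card_mono) (auto simp: W_def)
    moreover have "card (W - {v, w}) = card W - card {v, w}"
      using vW by (intro card_Diff_subset) (auto simp: W_def)
    ultimately show ?thesis using card_image[OF inj] by simp
  qed
  finally have "card W = card (insert {w, y} (insert {w, z} ?F))" by simp
  also have "\<dots> \<le> card {e \<in> E. e \<subseteq> W}"
  proof (rule card_mono)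
    show "finite {e \<in> E. e \<subseteq> W}" using finW by (auto intro: finite_subset[of _ "Pow W"])
    have "par u \<in> W \<and> {u, par u} \<in> E" if "u \<in> W - {v, w}" for u
      using par[of u] rW[of u] that P(6) Q(6) by (auto simp: W_def nbrs_def)
    then show "insert {w, y} (insert {w, z} ?F) \<subseteq> {e \<in> E. e \<subseteq> W}"
      using y z P Q by (auto simp: nbrs_def W_def)
  qed
  finally show False using lt by simp
qed

section \<open>The supersolution given by powers of \<open>tau c\<close>\<close>

lemma nbrs_irrefl:
  assumes "\<And>e. e \<in> E \<Longrightarrow> card e = 2"
  shows "v \<notin> nbrs E v"
  using assms[of "{v}"] by (auto simp: nbrs_def)

lemma tau_pos: "c \<ge> 0 \<Longrightarrow> tau c > 0"
  and tau_le_1: "c \<ge> 0 \<Longrightarrow> tau c \<le> 1"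
  and tau_sq: "c \<ge> 0 \<Longrightarrow> tau c * (tau c * (1 + c)) = 1"
  by (auto simp: tau_def real_le_rsqrt field_simps)

text \<open>The value \<open>\<tau>\<^sub>c\<close> is exactly the one for which the parent's surplus
  \<open>1 / \<tau>\<^sub>c - \<tau>\<^sub>c = c \<tau>\<^sub>c\<close> is compensated by the killing rate \<open>c\<close>.\<close>

lemma tau_power_supersolution:
  assumes c: "c \<ge> 0" and sp: "sparse_at (2 * k + 3) E v" and E2: "\<And>e. e \<in> E \<Longrightarrow> card e = 2"
    and fin: "finite (nbrs E w)" and w: "reach E v w" "gdist E v w \<le> k"
  shows "(\<Sum>x\<in>nbrs E w. tau c ^ gdist E v x)
           \<le> tau c * (c + card (nbrs E w)) * tau c ^ gdist E v w"
proof -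
  let ?t = "tau c" and ?d = "gdist E v"
  note t = tau_pos[OF c] tau_le_1[OF c]
  have far: "?t ^ ?d x \<le> ?t ^ Suc (?d w)" if "\<not> ?d x \<le> ?d w" for x
    using that t by (intro power_decreasing) auto
  show ?thesis
  proof (cases "w = v")
    case True
    have "?t ^ ?d x \<le> ?t ^ Suc (?d w)" if "x \<in> nbrs E w" for x
    proof (rule far)
      have "x \<noteq> v" using that True nbrs_irrefl[of E v] E2 by auto
      then have "?d x \<noteq> 0" using gdist_eq_0 reach_nbr(1)[OF w(1) that] by metis
      then show "\<not> ?d x \<le> ?d w" using True by simp
    qed
    then have "(\<Sum>x\<in>nbrs E w. ?t ^ ?d x) \<le> card (nbrs E w) * ?t ^ Suc (?d w)"
      using sum_bounded_above[of "nbrs E w" "\<lambda>x. ?t ^ ?d x" "?t ^ Suc (?d w)"] by simp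
    also have "\<dots> \<le> ?t * (c + card (nbrs E w)) * ?t ^ ?d w"
      using c t by (simp add: algebra_simps)
    finally show ?thesis .
  next
    case False
    obtain u where u: "u \<in> nbrs E w" "reach E v u" "?d u < ?d w"
      using gdist_parent[OF w(1) False] by auto
    obtain i where i: "?d w = Suc i" using u(3) by (cases "?d w") auto
    have "?d w \<le> Suc (?d u)" using reach_nbr(2)[OF u(2)] u(1) nbrs_sym by metis
    then have up: "?t ^ ?d u \<le> ?t ^ i" using i t by (intro power_decreasing) auto
    have "(\<Sum>x\<in>nbrs E w. ?t ^ ?d x) = ?t ^ ?d u + (\<Sum>x\<in>nbrs E w - {u}. ?t ^ ?d x)"
      using fin u by (subst sum.remove[of _ u]) auto
    \<comment> \<open>All neighbours except the unique parent \<open>u\<close> lie one step farther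
      out; only \<open>u\<close> can contribute the larger power with exponent \<open>i\<close>, one
      less than the distance of \<open>w\<close>.\<close>
    also have "\<dots> \<le> ?t ^ i + (\<Sum>x\<in>nbrs E w - {u}. ?t ^ Suc (?d w))"
    proof (intro add_mono up sum_mono far notI)
      fix x assume "x \<in> nbrs E w - {u}" "?d x \<le> ?d w"
      then show False
        using sparse_at_unique_parent[OF sp E2 w, of x u] u by auto
    qed
    also have "\<dots> = ?t ^ i + (real (card (nbrs E w)) - 1) * ?t ^ Suc (?d w)"
    proof -
      have "real (card (nbrs E w - {u})) = real (card (nbrs E w)) - 1"
        using card_Suc_Diff1[OF fin u(1)] by linarith
      then show ?thesis by simp
    qed
    \<comment> \<open>This is 1 / \<open>tau c\<close> = \<open>tau c * (1 + c)\<close>, the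
      defining equation of \<open>tau c\<close>.\<close>
    also have "?t ^ i = ?t * (1 + c) * ?t ^ ?d w"
    proof -
      have "?t * (1 + c) * ?t ^ Suc i = (?t * (?t * (1 + c))) * ?t ^ i" by simp
      then show ?thesis unfolding tau_sq[OF c] i by simp
    qed
    finally show ?thesis by (simp add: algebra_simps)
  qed
qed

section \<open>Order, linearity and bounds for iterated lazy steps\<close>

lemma lazy_step_mono:
  assumes "c \<ge> 0" and "g v \<le> h v" and "\<And>w. w \<in> nbrs E v \<Longrightarrow> g w \<le> h w"
  shows "lazy_step c E g v \<le> lazy_step c E h v"
  unfolding lazy_step_def using assms
  by (intro add_mono divide_right_mono sum_mono) auto

lemma lazy_step_cmult: "lazy_step c E (\<lambda>w. a * g w) v = a * lazy_step c E g v"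
  by (simp add: lazy_step_def sum_distrib_left[symmetric] algebra_simps)

lemma lazy_step_add: "lazy_step c E (\<lambda>w. g w + h w) v = lazy_step c E g v + lazy_step c E h v"
  by (simp add: lazy_step_def sum.distrib add_divide_distrib)

lemma funpow_lazy_step_mono:
  assumes "c \<ge> 0" "\<And>w. g w \<le> h w"
  shows "(lazy_step c E ^^ j) g v \<le> (lazy_step c E ^^ j) h v"
  using assms(2) by (induction j arbitrary: v) (auto intro!: lazy_step_mono[OF assms(1)])

lemma funpow_lazy_step_nonneg:
  assumes "c \<ge> 0" "\<And>w. g w \<ge> 0"
  shows "(lazy_step c E ^^ j) g v \<ge> 0"
proof (induction j arbitrary: v)
  case (Suc j)
  then show ?case using assms(1)
    by (auto simp: lazy_step_def intro!: add_nonneg_nonneg divide_nonneg_nonneg sum_nonneg)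
qed (use assms in auto)

text \<open>K is substochastic, so each application of I + K at most doubles a nonnegative constant
  bound. This crude estimate serves at the rare vertices that are not sparse.\<close>

lemma funpow_lazy_step_le_2_power:
  assumes "c \<ge> 0" "\<And>w. g w \<le> 1"
  shows "(lazy_step c E ^^ j) g v \<le> 2 ^ j"
proof (induction j arbitrary: v)
  case (Suc j)
  have "(lazy_step c E ^^ Suc j) g v \<le> lazy_step c E (\<lambda>_. 2 ^ j) v"
    using Suc by (auto intro!: lazy_step_mono[OF assms(1)])
  also have "\<dots> = 2 ^ j * (1 + card (nbrs E v) / (c + card (nbrs E v)))"
    by (simp add: lazy_step_def algebra_simps)
  also have "\<dots> \<le> 2 ^ j * (1 + 1)"
    using assms(1) by (intro mult_left_mono add_mono) (auto simp: divide_le_eq_1)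
  finally show ?case by simp
qed (use assms in auto)

text \<open>The point mass at \<open>v\<close> lies below the function
  \<open>tau c ^ gdist E v w\<close>, and by the supersolution inequality each lazy step inflates
  that function by at most 1 + \<open>tau c\<close> inside the ball of radius
  \<open>k\<close>.\<close>

lemma lazy_return_sparse_le:
  assumes c: "c \<ge> 0" and sp: "sparse_at (2 * k + 3) E v" and E2: "\<And>e. e \<in> E \<Longrightarrow> card e = 2"
    and fin: "\<And>w. finite (nbrs E w)"
  shows "(lazy_step c E ^^ k) (\<lambda>w. if w = v then 1 else 0) v \<le> (1 + tau c) ^ k"
proof -
  let ?t = "tau c" and ?d = "gdist E v"
  note t = tau_pos[OF c] tau_le_1[OF c]
  have "(lazy_step c E ^^ j) (\<lambda>w. ?t ^ ?d w) w \<le> (1 + ?t) ^ j * ?t ^ ?d w"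
    if "reach E v w" "?d w + j \<le> k" for w j
    using that
  proof (induction j arbitrary: w)
    case (Suc j)
    have "(lazy_step c E ^^ Suc j) (\<lambda>w. ?t ^ ?d w) w
        \<le> lazy_step c E (\<lambda>x. (1 + ?t) ^ j * ?t ^ ?d x) w"
      unfolding funpow.simps comp_def
      using Suc.prems reach_nbr[OF Suc.prems(1)]
      by (intro lazy_step_mono[OF c] Suc.IH) fastforce+
    also have "\<dots> = (1 + ?t) ^ j * (?t ^ ?d w + (\<Sum>x\<in>nbrs E w. ?t ^ ?d x) / (c + card (nbrs E w)))"
      unfolding lazy_step_cmult by (simp add: lazy_step_def)
    also have "\<dots> \<le> (1 + ?t) ^ j * (?t ^ ?d w + ?t * ?t ^ ?d w)"
    proof (intro mult_left_mono add_left_mono)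
      show "(\<Sum>x\<in>nbrs E w. ?t ^ ?d x) / (c + card (nbrs E w)) \<le> ?t * ?t ^ ?d w"
      proof (cases "nbrs E w = {}")
        case False
        then have "c + card (nbrs E w) > 0" using c fin by (simp add: add_nonneg_pos card_gt_0_iff)
        then show ?thesis
          using tau_power_supersolution[OF c sp E2 fin Suc.prems(1)] Suc.prems(2)
          by (simp add: pos_divide_le_eq mult_ac)
      qed (use t in auto)
    qed (use t in auto)
    also have "\<dots> = (1 + ?t) ^ Suc j * ?t ^ ?d w" by (simp add: algebra_simps)
    finally show ?case .
  qed simp
  from this[of v k] have "(lazy_step c E ^^ k) (\<lambda>w. ?t ^ ?d w) v \<le> (1 + ?t) ^ k"
    by (simp add: reach_refl)
  \<comment> \<open>Only \<open>gdist E v v = 0\<close> and positivity of the powers matter here, so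
    the unspecified distances of unreachable vertices are harmless.\<close>
  moreover have "(lazy_step c E ^^ k) (\<lambda>w. if w = v then 1 else 0) v
      \<le> (lazy_step c E ^^ k) (\<lambda>w. ?t ^ ?d w) v"
    using t by (intro funpow_lazy_step_mono[OF c]) auto
  ultimately show ?thesis by simp
qed

subsection \<open>Star components\<close>

definition star_at :: "nat \<Rightarrow> 'a set set \<Rightarrow> 'a \<Rightarrow> bool" where
  "star_at m E v \<longleftrightarrow> card (nbrs E v) = m \<and> v \<notin> nbrs E v \<and> (\<forall>w\<in>nbrs E v. nbrs E w = {v})"

text \<open>With value 1 at the centre and b at each leaf, the eigenvalue equations are l b = 1 / (1
  + c) at a leaf and l = m b / (c + m) at the centre. Eliminating b gives l^2 = m / ((c + m) (1 +
  c)).\<close>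

definition star_eigval :: "real \<Rightarrow> nat \<Rightarrow> real" where
  "star_eigval c m = sqrt (real m / ((c + real m) * (1 + c)))"

lemma star_eigval_tendsto: 
  assumes "c \<ge> 0" shows "star_eigval c \<longlonglongrightarrow> tau c"
proof -
  have "(\<lambda>m. real m / (c + real m)) \<longlonglongrightarrow> 1" by real_asymp
  then have "(\<lambda>m. sqrt (real m / (c + real m) / (1 + c))) \<longlonglongrightarrow> sqrt (1 / (1 + c))"
    using assms by (intro tendsto_intros) auto
  then show ?thesis by (simp add: star_eigval_def[abs_def] tau_def real_sqrt_divide)
qed

text \<open>Assuming only the square of \<open>l\<close> covers both signs of the eigenvalue at
  once.\<close>

lemma star_eigenfunction:
  assumes c: "c \<ge> 0" and m: "m \<ge> 1" and st: "star_at m E v"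
    and l: "l\<^sup>2 = (star_eigval c m)\<^sup>2"
  defines "f \<equiv> \<lambda>x. if x = v then 1 else if x \<in> nbrs E v then 1 / (l * (1 + c)) else 0"
  shows "(lazy_step c E ^^ j) f = (\<lambda>x. (1 + l) ^ j * f x)"
proof -
  let ?N = "nbrs E v"
  have l2: "l\<^sup>2 = real m / ((c + real m) * (1 + c))" using c unfolding l star_eigval_def by (subst real_sqrt_pow2) auto
  then have l0: "l \<noteq> 0" using c m by auto
  have cN: "card ?N = m" and vN: "v \<notin> ?N" and leaf: "\<And>w. w \<in> ?N \<Longrightarrow> nbrs E w = {v}"
    using st by (auto simp: star_at_def)
  have step: "lazy_step c E f x = (1 + l) * f x" for x
  proof -
    consider "x = v" | "x \<in> ?N" | "x \<noteq> v" "x \<notin> ?N" by blast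
    then show ?thesis
    proof cases
      case 1
      have "(\<Sum>w\<in>?N. f w) = m * (1 / (l * (1 + c)))"
        using vN cN by (subst sum.cong[of _ _ _ "\<lambda>_. 1 / (l * (1 + c))"]) (auto simp: f_def)
      moreover have "m * (1 / (l * (1 + c))) / (c + m) = l\<^sup>2 / l"
        unfolding l2 by (simp add: mult_ac)
      then have "m * (1 / (l * (1 + c))) / (c + m) = l"
        using l0 by (simp add: power2_eq_square)
      ultimately show ?thesis using 1 cN by (simp add: lazy_step_def f_def)
    next
      case 2
      have "x \<noteq> v" using 2 vN by auto
      then have "lazy_step c E f x = 1 / (l * (1 + c)) + 1 / (1 + c)" "f x = 1 / (l * (1 + c))"
        using 2 leaf[OF 2] by (simp_all add: lazy_step_def f_def add.commute)
      moreover have "1 / (l * (1 + c)) + 1 / (1 + c) = (1 + l) * (1 / (l * (1 + c)))"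
        using l0 c by (simp add: divide_simps)
      ultimately show ?thesis by simp
    next
      case 3
      \<comment> \<open>No vertex outside the star is adjacent to it, so extending the eigenfunction
        by zero keeps the equation valid everywhere.\<close>
      have "w \<noteq> v \<and> w \<notin> ?N" if "w \<in> nbrs E x" for w
      proof (intro conjI notI)
        have xw: "x \<in> nbrs E w" using that nbrs_sym by metis
        then show False if "w = v" using that 3 by simp
        show False if "w \<in> ?N" using leaf[OF that] xw 3 by simp
      qed
      then have "(\<Sum>w\<in>nbrs E x. f w) = 0" by (intro sum.neutral) (auto simp: f_def)
      then show ?thesis using 3 by (simp add: lazy_step_def f_def)
    qed
  qed
  show ?thesis
  proof (induction j)
    case (Suc j)
    show ?case unfolding funpow.simps comp_def Suc lazy_step_cmult step by (simp add: mult_ac)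
  qed simp
qed

text \<open>The leaf values are odd in the eigenvalue, so averaging the eigenfunctions for the two
  signs cancels them and leaves the point mass at the centre.\<close>

lemma lazy_return_star_ge:
  assumes c: "c \<ge> 0" and m: "m \<ge> 1" and st: "star_at m E v"
  shows "(lazy_step c E ^^ j) (\<lambda>w. if w = v then 1 else 0) v \<ge> (1 + star_eigval c m) ^ j / 2"
proof -
  let ?l = "star_eigval c m"
  define f where "f l x = (if x = v then 1 else if x \<in> nbrs E v then 1 / (l * (1 + c)) else 0)" for l x
  have eig: "(lazy_step c E ^^ j) (f l) v = (1 + l) ^ j" if "l = ?l \<or> l = - ?l" for l
  proof -
    have "f l = (\<lambda>x. if x = v then 1 else if x \<in> nbrs E v then 1 / (l * (1 + c)) else 0)"
      by (rule ext) (simp add: f_def)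
    moreover have "l\<^sup>2 = ?l\<^sup>2" using that by auto
    ultimately show ?thesis using star_eigenfunction[OF c m st, of l j] by simp
  qed
  have lin: "(lazy_step c E ^^ j) (\<lambda>x. 1/2 * g x + 1/2 * h x) x
      = 1/2 * (lazy_step c E ^^ j) g x + 1/2 * (lazy_step c E ^^ j) h x" for g h and x :: 'a
  proof (induction j arbitrary: x)
    case (Suc j)
    have "(lazy_step c E ^^ j) (\<lambda>x. 1/2 * g x + 1/2 * h x)
        = (\<lambda>x. 1/2 * (lazy_step c E ^^ j) g x + 1/2 * (lazy_step c E ^^ j) h x)"
      using Suc by (rule ext)
    then show ?case unfolding funpow.simps comp_def by (simp only: lazy_step_add lazy_step_cmult)
  qed simp
  have split: "(\<lambda>w. if w = v then 1 else 0) = (\<lambda>x. 1/2 * f ?l x + 1/2 * f (- ?l) x)"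
    by (auto simp: f_def fun_eq_iff)
  have "(lazy_step c E ^^ j) (\<lambda>w. if w = v then 1 else 0) v
      = 1/2 * (1 + ?l) ^ j + 1/2 * (1 - ?l) ^ j"
    unfolding split lin by (simp add: eig)
  moreover have "?l \<le> 1"
  proof -
    have "real m * 1 \<le> (c + real m) * (1 + c)" using c by (intro mult_mono) auto
    then show ?thesis using c m unfolding star_eigval_def
      by (simp add: divide_le_eq_1)
  qed
  ultimately show ?thesis by simp
qed

subsection \<open>Traces and the spectral distribution\<close>

lemma monic_split_proots:
  fixes q :: "'a :: field poly"
  assumes "monic q" "size (proots q) = degree q"
  shows "q = (\<Prod>x\<in>#proots q. [:-x, 1:])"
  using assms
proof (induction "degree q" arbitrary: q)
  case 0
  then have "q = 1" using monic_degree_0[of q] by simp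
  then show ?case by simp
next
  case (Suc m)
  then have "proots q \<noteq> {#}" by auto
  then obtain x where "x \<in># proots q" by blast
  then have "poly q x = 0" using Suc.prems(1) by (cases "q = 0") auto
  then obtain r where r: "q = [:-x, 1:] * r" by (metis dvdE poly_eq_0_iff_dvd)
  have r0: "r \<noteq> 0" using Suc.prems r by auto
  have "lead_coeff q = lead_coeff r" unfolding r lead_coeff_mult by simp
  then have mr: "monic r" using Suc.prems(1) by simp
  have deg: "degree q = Suc (degree r)" unfolding r using r0 by (subst degree_mult_eq) auto
  have pr: "proots q = add_mset x (proots r)"
    unfolding r using r0 by (subst proots_mult) auto
  have "r = (\<Prod>x\<in>#proots r. [:-x, 1:])"
    using Suc.hyps mr deg pr Suc.prems by simp
  then show ?case unfolding pr using r by simp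
qed

lemma upper_triangular_mult_diag:
  fixes A B :: "'a :: semiring_1 mat"
  assumes A: "A \<in> carrier_mat n n" "upper_triangular A"
    and B: "B \<in> carrier_mat n n" "upper_triangular B"
  shows "upper_triangular (A * B)" and "i < n \<Longrightarrow> (A * B) $$ (i, i) = A $$ (i, i) * B $$ (i, i)"
proof -
  have ent: "(A * B) $$ (i, j) = (\<Sum>l<n. A $$ (i, l) * B $$ (l, j))" if "i < n" "j < n" for i j
    using that A B by (simp add: scalar_prod_def lessThan_atLeast0)
  have z: "A $$ (i, l) * B $$ (l, j) = 0" if "i < n" "j < n" "l < n" "l < i \<or> j < l" for i j l
    using that upper_triangularD[OF A(2), of l i] upper_triangularD[OF B(2), of j l] A B by auto
  show "upper_triangular (A * B)"
  proof (rule upper_triangularI)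
    fix i j assume "j < i" "i < dim_row (A * B)"
    then have ij: "i < n" "j < n" "j < i" using A by auto
    show "(A * B) $$ (i, j) = 0"
      unfolding ent[OF ij(1,2)]
    proof (intro sum.neutral ballI)
      fix l assume "l \<in> {..<n}"
      then show "A $$ (i, l) * B $$ (l, j) = 0" using ij by (intro z) auto
    qed
  qed
  assume i: "i < n"
  have "(\<Sum>l<n. A $$ (i, l) * B $$ (l, i)) = (\<Sum>l\<in>{i}. A $$ (i, l) * B $$ (l, i))"
  proof (rule sum.mono_neutral_right)
    show "\<forall>l\<in>{..<n} - {i}. A $$ (i, l) * B $$ (l, i) = 0"
    proof
      fix l assume "l \<in> {..<n} - {i}"
      then show "A $$ (i, l) * B $$ (l, i) = 0" using i by (intro z) auto
    qed
  qed (use i in auto)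
  then show "(A * B) $$ (i, i) = A $$ (i, i) * B $$ (i, i)" using ent[OF i i] by simp
qed

lemma upper_triangular_pow_diag:
  fixes A :: "'a :: comm_semiring_1 mat"
  assumes A: "A \<in> carrier_mat n n" "upper_triangular A"
  shows "upper_triangular (A ^\<^sub>m k) \<and> (\<forall>i<n. (A ^\<^sub>m k) $$ (i, i) = (A $$ (i, i)) ^ k)"
proof (induction k)
  case (Suc k)
  then show ?case
    using upper_triangular_mult_diag[OF pow_carrier_mat[OF A(1)] _ A, of k] by (simp add: mult_ac)
qed (use A in auto)

lemma sum_diag_mult_commute:
  fixes A B :: "'a :: comm_semiring_1 mat"
  assumes "A \<in> carrier_mat n n" "B \<in> carrier_mat n n"
  shows "(\<Sum>i<n. (A * B) $$ (i, i)) = (\<Sum>i<n. (B * A) $$ (i, i))"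
proof -
  have "(\<Sum>i<n. (A * B) $$ (i, i)) = (\<Sum>i<n. \<Sum>j<n. A $$ (i, j) * B $$ (j, i))"
    using assms by (simp add: scalar_prod_def lessThan_atLeast0)
  also have "\<dots> = (\<Sum>j<n. \<Sum>i<n. B $$ (j, i) * A $$ (i, j))"
    by (subst sum.swap) (simp add: mult.commute)
  also have "\<dots> = (\<Sum>i<n. (B * A) $$ (i, i))"
    using assms by (simp add: scalar_prod_def lessThan_atLeast0)
  finally show ?thesis .
qed

text \<open>With all roots real, a Schur decomposition over the reals gives A = P U Q with Q inverse
  to P and U triangular carrying the eigenvalues on its diagonal. The same P and Q conjugate 1 + A
  to 1 + U, the trace is invariant under conjugation, and powers act entrywise on the diagonal of a
  triangular matrix.\<close>

lemma trace_pow_eq_sum_eigenvalues: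
  fixes A :: "real mat"
  assumes A: "A \<in> carrier_mat n n" and sz: "size (proots (char_poly A)) = n"
  shows "(\<Sum>i<n. ((1\<^sub>m n + A) ^\<^sub>m k) $$ (i, i)) = (\<Sum>x\<in>#proots (char_poly A). (1 + x) ^ k)"
proof -
  note dm = degree_monic_char_poly[OF A]
  obtain es where es: "mset es = proots (char_poly A)" using ex_mset by auto
  have "char_poly A = (\<Prod>x\<in>#mset es. [:-x, 1:])"
    unfolding es using dm sz by (intro monic_split_proots) auto
  then have cp: "char_poly A = (\<Prod>e\<leftarrow>es. [:-e, 1:])"
    by (metis mset_map prod_mset_prod_list)
  obtain U P Q where "schur_decomposition A es = (U, P, Q)" by (cases "schur_decomposition A es")
  from schur_decomposition[OF A cp this]
  have sim: "similar_mat_wit A U P Q" and ut: "upper_triangular U" and dg: "diag_mat U = es" by auto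
  note w = similar_mat_witD2[OF A sim]
  have U: "U \<in> carrier_mat n n" and P: "P \<in> carrier_mat n n" and Q: "Q \<in> carrier_mat n n"
    and PQ: "P * Q = 1\<^sub>m n" and QP: "Q * P = 1\<^sub>m n" and AU: "A = P * U * Q" using w by auto
  let ?V = "1\<^sub>m n + U"
  have V: "?V \<in> carrier_mat n n" using U by simp
  have utV: "upper_triangular ?V"
  proof (rule upper_triangularI)
    fix i j assume "j < i" "i < dim_row ?V"
    then show "?V $$ (i, j) = 0" using U upper_triangularD[OF ut, of j i] by simp
  qed
  have "P * ?V * Q = (P + P * U) * Q"
    using mult_add_distrib_mat[OF P one_carrier_mat U] P by simp
  also have "\<dots> = 1\<^sub>m n + A"
    using add_mult_distrib_mat[OF P mult_carrier_mat[OF P U] Q] PQ AU by simp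
  finally have "1\<^sub>m n + A = P * ?V * Q" ..
  then have "similar_mat_wit (1\<^sub>m n + A) ?V P Q"
    using A V P Q PQ QP by (intro similar_mat_witI[of P Q n]) auto
  from similar_mat_wit_pow_id[OF this, of k]
  have pow: "(1\<^sub>m n + A) ^\<^sub>m k = P * (?V ^\<^sub>m k * Q)"
    using P Q V by (simp add: assoc_mult_mat[of _ n n _ n _ n])
  have "(\<Sum>i<n. ((1\<^sub>m n + A) ^\<^sub>m k) $$ (i, i)) = (\<Sum>i<n. (?V ^\<^sub>m k * Q * P) $$ (i, i))"
    unfolding pow by (rule sum_diag_mult_commute[OF P mult_carrier_mat[OF pow_carrier_mat[OF V] Q]])
  also have "?V ^\<^sub>m k * Q * P = ?V ^\<^sub>m k"
    unfolding assoc_mult_mat[OF pow_carrier_mat[OF V] Q P] QP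
    by (rule right_mult_one_mat[OF pow_carrier_mat[OF V]])
  also have "(\<Sum>i<n. (?V ^\<^sub>m k) $$ (i, i)) = (\<Sum>i<n. (1 + U $$ (i, i)) ^ k)"
    using upper_triangular_pow_diag[OF V utV, of k] U by auto
  also have "\<dots> = (\<Sum>x\<leftarrow>es. (1 + x) ^ k)"
    unfolding dg[symmetric] diag_mat_def using U
    by (simp add: comp_def interv_sum_list_conv_sum_set_nat lessThan_atLeast0)
  also have "\<dots> = (\<Sum>x\<in>#mset es. (1 + x) ^ k)"
    by (metis mset_map sum_mset_sum_list)
  finally show ?thesis unfolding es .
qed

lemma sum_mset_eq_sum_count:
  fixes f :: "'a \<Rightarrow> real"
  assumes "finite S" "set_mset M \<subseteq> S"
  shows "(\<Sum>x\<in>#M. f x) = (\<Sum>x\<in>S. real (count M x) * f x)"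
  using assms(2)
proof (induction M)
  case (add a M)
  have "(\<Sum>x\<in>S. real (count (add_mset a M) x) * f x)
      = (\<Sum>x\<in>S. real (count M x) * f x + (if x = a then f x else 0))"
    by (intro sum.cong) (auto simp: algebra_simps)
  then show ?case using add assms(1) by (simp add: sum.distrib)
qed simp

lemma integral_pmf_of_multiset:
  fixes f :: "'a \<Rightarrow> real"
  assumes "M \<noteq> {#}"
  shows "(\<integral>x. f x \<partial>measure_pmf (pmf_of_multiset M)) = (\<Sum>x\<in>#M. f x) / size M"
proof -
  have "(\<integral>x. f x \<partial>measure_pmf (pmf_of_multiset M))
      = (\<Sum>x\<in>set_mset M. f x * (count M x / size M))"
    using assms by (subst integral_measure_pmf_real[of "set_mset M"]) auto
  also have "\<dots> = (\<Sum>x\<in>set_mset M. real (count M x) * f x) / size M"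
    by (simp add: sum_divide_distrib mult_ac)
  also have "(\<Sum>x\<in>set_mset M. real (count M x) * f x) = (\<Sum>x\<in>#M. f x)"
    by (rule sum_mset_eq_sum_count[symmetric]) auto
  finally show ?thesis .
qed

section \<open>The walk matrix as an averaging operator\<close>

lemma nbrs_vertex_pairs:
  assumes "E \<subseteq> vertex_pairs n"
  shows "nbrs E v \<subseteq> {1..n}" "finite (nbrs E v)"
proof -
  show *: "nbrs E v \<subseteq> {1..n}" using assms by (auto simp: nbrs_def vertex_pairs_def)
  show "finite (nbrs E v)" using * by (rule finite_subset) simp
qed

lemma walk_mat_sum:
  assumes c: "c \<ge> 0" and E: "E \<subseteq> vertex_pairs n" and i: "i < n"
  shows "(\<Sum>j<n. walk_mat c n E $$ (i, j) * g (Suc j))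
    = (\<Sum>w\<in>nbrs E (Suc i). g w) / (c + card (nbrs E (Suc i)))"
proof -
  let ?N = "nbrs E (Suc i)"
  have N: "?N \<subseteq> {1..n}" "finite ?N" using nbrs_vertex_pairs[OF E] by auto
  have adj: "(\<Sum>j<n. adjacency_mat n E $$ (i, j) * h (Suc j)) = (\<Sum>w\<in>?N. h w)" for h :: "nat \<Rightarrow> real"
  proof -
    have "(\<Sum>j<n. adjacency_mat n E $$ (i, j) * h (Suc j))
        = (\<Sum>j<n. if Suc j \<in> ?N then h (Suc j) else 0)"
      using i by (intro sum.cong) (auto simp: adjacency_mat_def nbrs_def)
    also have "\<dots> = (\<Sum>w\<in>{1..n}. if w \<in> ?N then h w else 0)"
      by (simp add: sum.atLeast1_atMost_eq)
    also have "\<dots> = (\<Sum>w\<in>?N. h w)"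
      using N by (simp add: sum.If_cases Int_absorb1)
    finally show ?thesis .
  qed
  show ?thesis
  proof (cases "?N = {}")
    case True
    then have "walk_mat c n E $$ (i, j) = 0" if "j < n" for j
      using i that by (auto simp: walk_mat_eq(2)[OF c] adjacency_mat_def nbrs_def)
    then show ?thesis using True by simp
  next
    case False
    then obtain w where w: "w \<in> ?N" by auto
    then obtain j where j: "w = Suc j" "j < n" using N by (cases w) force+
    \<comment> \<open>A nonzero row rules out the default value 1 in \<open>deg_mat\<close>, leaving
      \<open>c\<close> plus the degree.\<close>
    then have "row (adjacency_mat n E) i $ j \<noteq> 0"
      using i w by (simp add: adjacency_mat_def nbrs_def)
    then have "row (adjacency_mat n E) i \<noteq> 0\<^sub>v n" using j by auto
    then have deg: "deg_entry c n E i = c + card ?N"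
      using i adj[of "\<lambda>_. 1"] by (simp add: deg_entry_def deg_mat_def)
    have "(\<Sum>j<n. walk_mat c n E $$ (i, j) * g (Suc j))
        = (\<Sum>j<n. adjacency_mat n E $$ (i, j) * g (Suc j)) / deg_entry c n E i"
      using i by (simp add: walk_mat_eq(2)[OF c] sum_divide_distrib)
    then show ?thesis unfolding adj deg .
  qed
qed

text \<open>The induction absorbs the last matrix factor into \<open>g\<close>, so \<open>g\<close>
  has to be arbitrary.\<close>

lemma walk_mat_pow:
  assumes c: "c \<ge> 0" and E: "E \<subseteq> vertex_pairs n" and i: "i < n"
  shows "(\<Sum>j<n. ((1\<^sub>m n + walk_mat c n E) ^\<^sub>m k) $$ (i, j) * g (Suc j)) = (lazy_step c E ^^ k) g (Suc i)"
proof (induction k arbitrary: g)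
  case 0
  have "walk_mat c n E \<in> carrier_mat n n" by (simp add: walk_mat_eq(2)[OF c])
  then show ?case using i by (simp add: if_distrib[of "\<lambda>x. x * _"] cong: if_cong)
next
  case (Suc k)
  let ?K = "walk_mat c n E"
  let ?B = "1\<^sub>m n + ?K"
  have K: "?K \<in> carrier_mat n n" by (simp add: walk_mat_eq(2)[OF c])
  have B: "?B \<in> carrier_mat n n" using K by simp
  have row: "(\<Sum>j<n. ?B $$ (l, j) * g (Suc j)) = lazy_step c E g (Suc l)" if l: "l < n" for l
  proof -
    have "(\<Sum>j<n. ?B $$ (l, j) * g (Suc j))
        = (\<Sum>j<n. (if l = j then g (Suc j) else 0) + ?K $$ (l, j) * g (Suc j))"
      using K l by (intro sum.cong) (auto simp: algebra_simps)
    then show ?thesis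
      using walk_mat_sum[OF c E l, of g] l by (simp add: sum.distrib lazy_step_def)
  qed
  have "(\<Sum>j<n. (?B ^\<^sub>m Suc k) $$ (i, j) * g (Suc j))
      = (\<Sum>j<n. \<Sum>l<n. (?B ^\<^sub>m k) $$ (i, l) * (?B $$ (l, j) * g (Suc j)))"
  proof (intro sum.cong refl)
    fix j assume "j \<in> {..<n}"
    moreover have "?B ^\<^sub>m k \<in> carrier_mat n n" using B by simp
    ultimately have "(?B ^\<^sub>m Suc k) $$ (i, j) = (\<Sum>l<n. (?B ^\<^sub>m k) $$ (i, l) * ?B $$ (l, j))"
      using B i by (simp add: scalar_prod_def lessThan_atLeast0 del: index_add_mat)
    then show "(?B ^\<^sub>m Suc k) $$ (i, j) * g (Suc j)
        = (\<Sum>l<n. (?B ^\<^sub>m k) $$ (i, l) * (?B $$ (l, j) * g (Suc j)))"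
      by (simp only: sum_distrib_right mult.assoc)
  qed
  also have "\<dots> = (\<Sum>l<n. (?B ^\<^sub>m k) $$ (i, l) * lazy_step c E g (Suc l))"
    using row by (subst sum.swap) (simp add: sum_distrib_left[symmetric])
  also have "\<dots> = (lazy_step c E ^^ Suc k) g (Suc i)"
    using Suc[of "lazy_step c E g"] by (simp add: funpow_swap1)
  finally show ?case .
qed

text \<open>Evaluate the eigenvector equation at a coordinate of maximal modulus: the row has
  nonnegative entries of sum at most 1. The bound shows that the truncation in
  \<open>test_fun\<close> is inactive on the spectrum.\<close>

lemma walk_mat_eigenvalue_bound:
  assumes c: "c \<ge> 0" and E: "E \<subseteq> vertex_pairs n" and x: "poly (char_poly (walk_mat c n E)) x = 0"
  shows "\<bar>x\<bar> \<le> 1"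
proof -
  let ?K = "walk_mat c n E"
  have K: "?K \<in> carrier_mat n n" by (simp add: walk_mat_eq(2)[OF c])
  have "eigenvalue ?K x" using x K by (simp add: eigenvalue_root_char_poly)
  then obtain v where v: "v \<in> carrier_vec n" "v \<noteq> 0\<^sub>v n" and ev: "?K *\<^sub>v v = x \<cdot>\<^sub>v v"
    using K unfolding eigenvalue_def eigenvector_def by auto
  obtain i0 where i0: "i0 < n" "v $ i0 \<noteq> 0" using v by (auto simp: vec_eq_iff)
  define b where "b = Max ((\<lambda>i. \<bar>v $ i\<bar>) ` {..<n})"
  have "b \<in> (\<lambda>i. \<bar>v $ i\<bar>) ` {..<n}" unfolding b_def using i0 by (intro Max_in) auto
  then obtain i where i: "i < n" "b = \<bar>v $ i\<bar>" by auto
  have le: "\<bar>v $ j\<bar> \<le> b" if "j < n" for j unfolding b_def using that by (intro Max_ge) auto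
  have b0: "b > 0" using le[OF i0(1)] i0(2) by linarith
  have nn: "?K $$ (i, j) \<ge> 0" if "j < n" for j
    using i that deg_entry_pos[OF c i(1), of E] by (simp add: walk_mat_eq(2)[OF c] adjacency_mat_def)
  have "\<bar>x\<bar> * b = \<bar>\<Sum>j<n. ?K $$ (i, j) * v $ j\<bar>"
    using arg_cong[OF ev, of "\<lambda>w. w $ i"] i v K
    by (simp add: scalar_prod_def lessThan_atLeast0 abs_mult)
  also have "\<dots> \<le> (\<Sum>j<n. \<bar>?K $$ (i, j) * v $ j\<bar>)" by (rule sum_abs)
  also have "\<dots> \<le> (\<Sum>j<n. ?K $$ (i, j) * b)"
    using nn le by (intro sum_mono) (auto simp: abs_mult intro!: mult_left_mono)
  also have "\<dots> = card (nbrs E (Suc i)) / (c + card (nbrs E (Suc i))) * b"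
    using walk_mat_sum[OF c E i(1), of "\<lambda>_. b"] by simp
  also have "\<dots> \<le> 1 * b"
    using b0 c by (intro mult_right_mono) (auto simp: divide_le_eq_1)
  finally show ?thesis using b0 by simp
qed

text \<open>The test functions of the moment argument: \<open>(1 + x)\<^sup>k\<close> on the spectrum, truncated so as to be bounded.
  The cap at \<open>2\<close> rather than \<open>1\<close> keeps them strictly increasing across \<open>\<tau>\<^sub>0 = 1\<close>.\<close>

definition test_fun :: "nat \<Rightarrow> real \<Rightarrow> real" where
  "test_fun k x = (1 + min 2 (max (- 1) x)) ^ k"

lemma integral_esd_walk_mat:
  assumes c: "c \<ge> 0" and E: "E \<subseteq> vertex_pairs n" and n: "n > 0"
  shows "(\<integral>x. test_fun k x \<partial>esd (walk_mat c n E))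
    = (\<Sum>v\<in>{1..n}. (lazy_step c E ^^ k) (\<lambda>w. if w = v then 1 else 0) v) / n"
proof -
  let ?K = "walk_mat c n E"
  have K: "?K \<in> carrier_mat n n" by (simp add: walk_mat_eq(2)[OF c])
  note sz = size_eigenvalues_walk_mat[OF c, of n E]
  have ne: "char_poly ?K \<noteq> 0" using degree_monic_char_poly[OF K] by auto
  have "proots (char_poly ?K) \<noteq> {#}" using sz n by auto
  then have "(\<integral>x. test_fun k x \<partial>esd ?K) = (\<Sum>x\<in>#proots (char_poly ?K). test_fun k x) / n"
    unfolding esd_def by (simp add: integral_pmf_of_multiset sz)
  also have "(\<Sum>x\<in>#proots (char_poly ?K). test_fun k x) = (\<Sum>x\<in>#proots (char_poly ?K). (1 + x) ^ k)"
  proof (intro arg_cong[of _ _ sum_mset] image_mset_cong)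
    fix x assume "x \<in># proots (char_poly ?K)"
    then have "\<bar>x\<bar> \<le> 1" using ne by (intro walk_mat_eigenvalue_bound[OF c E]) auto
    then have "min 2 (max (- 1) x) = x" by linarith
    then show "test_fun k x = (1 + x) ^ k" by (simp add: test_fun_def)
  qed
  also have "\<dots> = (\<Sum>i<n. ((1\<^sub>m n + ?K) ^\<^sub>m k) $$ (i, i))"
    using trace_pow_eq_sum_eigenvalues[OF K sz] by simp
  also have "\<dots> = (\<Sum>i<n. (lazy_step c E ^^ k) (\<lambda>w. if w = Suc i then 1 else 0) (Suc i))"
  proof (intro sum.cong refl)
    fix i assume i: "i \<in> {..<n}"
    have "((1\<^sub>m n + ?K) ^\<^sub>m k) $$ (i, i)
        = (\<Sum>j<n. ((1\<^sub>m n + ?K) ^\<^sub>m k) $$ (i, j) * (if Suc j = Suc i then 1 else 0))"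
      using i by (simp add: if_distrib[of "\<lambda>x. _ * x"] cong: if_cong)
    also have "\<dots> = (lazy_step c E ^^ k) (\<lambda>w. if w = Suc i then 1 else 0) (Suc i)"
      using i by (subst walk_mat_pow[OF c E, symmetric]) auto
    finally show "((1\<^sub>m n + ?K) ^\<^sub>m k) $$ (i, i)
      = (lazy_step c E ^^ k) (\<lambda>w. if w = Suc i then 1 else 0) (Suc i)" .
  qed
  also have "\<dots> = (\<Sum>v\<in>{1..n}. (lazy_step c E ^^ k) (\<lambda>w. if w = v then 1 else 0) v)"
    by (simp add: sum.atLeast1_atMost_eq)
  finally show ?thesis .
qed

subsection \<open>Local structure of sparse random graphs\<close>

lemma finite_vertex_pairs: "finite (vertex_pairs n)"
  by (rule finite_subset[of _ "Pow {1..n}"]) (auto simp: vertex_pairs_def)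

lemma set_erdos_renyi: "E \<in> set_pmf (erdos_renyi n a) \<Longrightarrow> E \<subseteq> vertex_pairs n"
  by (auto simp: erdos_renyi_def)

lemma prob_erdos_renyi:
  fixes a :: real
  assumes a: "0 \<le> a" "a \<le> 1" and S: "S \<subseteq> vertex_pairs n" and T: "T \<subseteq> vertex_pairs n"
    and ST: "S \<inter> T = {}"
  shows "measure_pmf.prob (erdos_renyi n a) {E. S \<subseteq> E \<and> T \<inter> E = {}} = a ^ card S * (1 - a) ^ card T"
proof -
  let ?V = "vertex_pairs n"
  note fin = finite_vertex_pairs[of n]
  define B where "B e = (if e \<in> S then {True} else if e \<in> T then {False} else UNIV)" for e :: "nat set"
  have "measure_pmf.prob (erdos_renyi n a) {E. S \<subseteq> E \<and> T \<inter> E = {}}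
      = measure_pmf.prob (Pi_pmf ?V False (\<lambda>_. bernoulli_pmf a)) (Pi ?V B)"
  proof -
    have "(\<lambda>\<omega>. {e \<in> ?V. \<omega> e}) -` {E. S \<subseteq> E \<and> T \<inter> E = {}} = Pi ?V B"
      using S T ST by (fastforce simp: B_def Pi_iff split: if_splits)
    then show ?thesis by (simp add: erdos_renyi_def)
  qed
  also have "\<dots> = (\<Prod>e\<in>?V. measure_pmf.prob (bernoulli_pmf a) (B e))"
    by (rule measure_Pi_pmf_Pi[OF fin])
  also have "\<dots> = (\<Prod>e\<in>?V. (if e \<in> S then a else 1) * (if e \<in> T then 1 - a else 1))"
    using a ST by (intro prod.cong) (auto simp: B_def measure_pmf_single)
  also have "\<dots> = a ^ card S * (1 - a) ^ card T"
    using S T fin by (simp add: prod.distrib prod.If_cases Int_absorb1)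
  finally show ?thesis .
qed

text \<open>Since \<open>v\<close> is prescribed, only m - 1 vertices are free. The factor n saved
  here becomes the 1/n in the next estimate.\<close>

lemma card_subsets_containing_le:
  assumes "v \<in> {1..n}" "m \<ge> 1"
  shows "card {W. W \<subseteq> {1..n} \<and> v \<in> W \<and> card W = m} \<le> n ^ (m - 1)"
proof -
  let ?A = "{X. X \<subseteq> {1..n} - {v} \<and> card X = m - 1}"
  have "{W. W \<subseteq> {1..n} \<and> v \<in> W \<and> card W = m} \<subseteq> insert v ` ?A"
  proof
    fix W assume W: "W \<in> {W. W \<subseteq> {1..n} \<and> v \<in> W \<and> card W = m}"
    then have "W = insert v (W - {v})" "W - {v} \<in> ?A" by auto
    then show "W \<in> insert v ` ?A" by blast
  qed
  then have "card {W. W \<subseteq> {1..n} \<and> v \<in> W \<and> card W = m} \<le> card ?A"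
    by (rule surj_card_le[rotated]) simp
  also have "\<dots> = (n - 1) choose (m - 1)"
    using assms by (subst n_subsets) auto
  also have "\<dots> \<le> n ^ (m - 1)"
  proof (cases "m - 1 \<le> n - 1")
    case True
    then have "(n - 1) choose (m - 1) \<le> (n - 1) ^ (m - 1)" by (rule binomial_le_pow)
    also have "\<dots> \<le> n ^ (m - 1)" by (intro power_mono) auto
    finally show ?thesis .
  qed (simp add: binomial_eq_0)
  finally show ?thesis .
qed

text \<open>Union bound over vertex sets of size m containing \<open>v\<close> (at most n^(m-1)) and
  sets of m edges inside them (at most 2^(2^m), counting all families of subsets), each present with
  probability (p/n)^m.\<close>

lemma prob_not_sparse_le:
  assumes p: "p \<ge> 0" "p \<le> real n" and n: "n > 0" and v: "v \<in> {1..n}"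
  shows "measure_pmf.prob (erdos_renyi n (p / n)) {E. E \<subseteq> vertex_pairs n \<and> \<not> sparse_at L E v}
     \<le> (\<Sum>m\<in>{1..L}. 2 ^ 2 ^ m * p ^ m) / n"
proof -
  let ?M = "erdos_renyi n (p / n)" and ?V = "vertex_pairs n"
  let ?W = "\<lambda>m. {W. W \<subseteq> {1..n} \<and> v \<in> W \<and> card W = m}"
  let ?F = "\<lambda>m W. {F. F \<subseteq> ?V \<inter> Pow W \<and> card F = m}"
  have a: "0 \<le> p / n" "p / n \<le> 1" using p n by auto
  have finW: "finite (?W m)" for m by (rule finite_subset[of _ "Pow {1..n}"]) auto
  have finF: "finite (?F m W)" for m W
    by (rule finite_subset[of _ "Pow ?V"]) (auto simp: finite_vertex_pairs)
  have sub: "{E. E \<subseteq> ?V \<and> \<not> sparse_at L E v}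
      \<subseteq> (\<Union>m\<in>{1..L}. \<Union>W\<in>?W m. \<Union>F\<in>?F m W. {E. F \<subseteq> E})"
  proof
    fix E assume "E \<in> {E. E \<subseteq> ?V \<and> \<not> sparse_at L E v}"
    then obtain X where E: "E \<subseteq> ?V" and X: "finite X" "v \<in> X" "card X \<le> L"
        "card {e \<in> E. e \<subseteq> X} \<ge> card X"
      unfolding sparse_at_def by auto
    obtain F where F: "F \<subseteq> {e \<in> E. e \<subseteq> X}" "card F = card X"
      by (rule obtain_subset_with_card_n[OF X(4)])
    \<comment> \<open>\<open>sparse_at\<close> quantifies over all finite sets, so \<open>X\<close>
      may leave \<open>{1..n}\<close>. Restricting it loses no edge and can only lower the vertex
      count; surplus edges are then discarded to get \<open>G\<close>.\<close>
    let ?X = "X \<inter> {1..n}"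
    have in_X: "e \<subseteq> ?X" if "e \<in> F" for e
      using that F(1) E by (auto simp: vertex_pairs_def)
    show "E \<in> (\<Union>m\<in>{1..L}. \<Union>W\<in>?W m. \<Union>F\<in>?F m W. {E. F \<subseteq> E})"
    proof -
      let ?m = "card ?X"
      have "v \<in> ?X" "finite ?X" using X v by auto
      then have "card ?X \<noteq> 0" by (metis card_eq_0_iff empty_iff)
      then have m: "1 \<le> ?m" by linarith
      have m': "?m \<le> card X" using X by (intro card_mono) auto
      obtain G where G: "G \<subseteq> F" "card G = ?m"
        using obtain_subset_with_card_n[of ?m F] m' F(2) by metis
      have "?m \<in> {1..L}" using m m' X(3) by auto
      moreover have "?X \<in> ?W ?m" using X v by auto
      moreover have "G \<in> ?F ?m ?X" 
      proof -
        have "e \<in> vertex_pairs n \<inter> Pow ?X" if "e \<in> G" for e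
          using that G(1) F(1) E in_X[of e] by blast
        then show ?thesis using G(2) by blast
      qed
      moreover have "G \<subseteq> E" using G F by auto
      ultimately show ?thesis 
        by (intro UN_I[of ?m] UN_I[of ?X] UN_I[of G]) (assumption+, rule CollectI, assumption)
    qed
  qed
  have pF: "measure_pmf.prob ?M {E. F \<subseteq> E} = (p / n) ^ m" if "F \<in> ?F m W" for F m W
    using prob_erdos_renyi[OF a, of F n "{}"] that by auto
  have "measure_pmf.prob ?M {E. E \<subseteq> ?V \<and> \<not> sparse_at L E v}
      \<le> measure_pmf.prob ?M (\<Union>m\<in>{1..L}. \<Union>W\<in>?W m. \<Union>F\<in>?F m W. {E. F \<subseteq> E})"
    by (intro measure_pmf.finite_measure_mono sub) auto
  also have "\<dots> \<le> (\<Sum>m\<in>{1..L}. measure_pmf.prob ?M (\<Union>W\<in>?W m. \<Union>F\<in>?F m W. {E. F \<subseteq> E}))"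
    by (intro measure_pmf.finite_measure_subadditive_finite) auto
  also have "\<dots> \<le> (\<Sum>m\<in>{1..L}. \<Sum>W\<in>?W m. measure_pmf.prob ?M (\<Union>F\<in>?F m W. {E. F \<subseteq> E}))"
    using finW by (intro sum_mono measure_pmf.finite_measure_subadditive_finite) auto
  also have "\<dots> \<le> (\<Sum>m\<in>{1..L}. \<Sum>W\<in>?W m. \<Sum>F\<in>?F m W. measure_pmf.prob ?M {E. F \<subseteq> E})"
    using finF by (intro sum_mono measure_pmf.finite_measure_subadditive_finite) auto
  also have "\<dots> = (\<Sum>m\<in>{1..L}. \<Sum>W\<in>?W m. card (?F m W) * (p / n) ^ m)"
  proof (intro sum.cong refl)
    fix m W
    have "(\<Sum>F\<in>?F m W. measure_pmf.prob ?M {E. F \<subseteq> E}) = (\<Sum>F\<in>?F m W. (p / n) ^ m)"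
      by (intro sum.cong refl pF)
    then show "(\<Sum>F\<in>?F m W. measure_pmf.prob ?M {E. F \<subseteq> E}) = card (?F m W) * (p / n) ^ m" by simp
  qed
  also have "\<dots> \<le> (\<Sum>m\<in>{1..L}. \<Sum>W\<in>?W m. 2 ^ 2 ^ m * (p / n) ^ m)"
  proof (intro sum_mono mult_right_mono)
    fix m W assume "m \<in> {1..L}" and W: "W \<in> ?W m"
    then have "finite W" by (auto intro: finite_subset)
    then have "card (?F m W) \<le> card (Pow (Pow W))" by (intro card_mono) auto
    also have "\<dots> = 2 ^ 2 ^ m" using \<open>finite W\<close> W by (simp add: card_Pow)
    finally show "real (card (?F m W)) \<le> 2 ^ 2 ^ m" by (metis of_nat_le_iff of_nat_numeral of_nat_power)
  qed (use a in auto)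
  also have "\<dots> = (\<Sum>m\<in>{1..L}. card (?W m) * (2 ^ 2 ^ m * (p / n) ^ m))" by simp
  also have "\<dots> \<le> (\<Sum>m\<in>{1..L}. real n ^ (m - 1) * (2 ^ 2 ^ m * (p / n) ^ m))"
  proof (intro sum_mono mult_right_mono)
    fix m assume "m \<in> {1..L}"
    then have "card (?W m) \<le> n ^ (m - 1)" using card_subsets_containing_le[OF v, of m] by simp
    then show "real (card (?W m)) \<le> real n ^ (m - 1)" by (metis of_nat_le_iff of_nat_power)
  qed (use a in auto)
  also have "\<dots> = (\<Sum>m\<in>{1..L}. 2 ^ 2 ^ m * p ^ m) / n"
    unfolding sum_divide_distrib
  proof (intro sum.cong refl)
    fix m assume "m \<in> {1..L}"
    then obtain j where "m = Suc j" by (cases m) auto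
    then show "real n ^ (m - 1) * (2 ^ 2 ^ m * (p / n) ^ m) = 2 ^ 2 ^ m * p ^ m / n"
      using n by (simp add: power_divide field_simps)
  qed
  finally show ?thesis .
qed

text \<open>Sum over the possible leaf sets. The events \<open>ev L\<close> are disjoint because the
  leaf set is recovered as the neighbourhood of \<open>v\<close>; each prescribes m edges and
  forbids every other pair meeting the star.\<close>

lemma prob_star_ge:
  fixes a :: real
  assumes a: "0 \<le> a" "a \<le> 1" and v: "v \<in> {1..n}"
  shows "measure_pmf.prob (erdos_renyi n a) {E. E \<subseteq> vertex_pairs n \<and> star_at m E v}
     \<ge> ((n - 1) choose m) * a ^ m * (1 - a) ^ ((m + 1) * n)"
proof -
  let ?M = "erdos_renyi n a" and ?V = "vertex_pairs n"
  define LL where "LL = {L. L \<subseteq> {1..n} - {v} \<and> card L = m}"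
  define S where "S L = (\<lambda>w. {v, w}) ` L" for L
  define T where "T L = {e \<in> ?V. e \<inter> insert v L \<noteq> {}} - S L" for L
  define ev where "ev L = {E. S L \<subseteq> E \<and> T L \<inter> E = {}} \<inter> {E. E \<subseteq> ?V}" for L
  have finLL: "finite LL" unfolding LL_def by (rule finite_subset[of _ "Pow {1..n}"]) auto
  have cLL: "card LL = (n - 1) choose m" unfolding LL_def using v by (subst n_subsets) auto
  have vL: "v \<notin> L" "L \<subseteq> {1..n}" "finite L" "card L = m" if "L \<in> LL" for L
    using that by (auto simp: LL_def intro: finite_subset)
  have SV: "S L \<subseteq> ?V" if "L \<in> LL" for L
    using vL[OF that] v by (auto simp: S_def vertex_pairs_def card_insert_if)
  have nb: "nbrs E v = L \<and> (\<forall>w\<in>L. nbrs E w = {v})" if L: "L \<in> LL" and E: "E \<in> ev L" for E L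
  proof -
    have inS: "e \<in> S L" if "e \<in> E" "e \<inter> insert v L \<noteq> {}" for e
      using E that by (auto simp: ev_def T_def)
    have SE: "S L \<subseteq> E" using E by (simp add: ev_def)
    have "nbrs E v = L"
    proof (intro equalityI subsetI)
      fix w assume "w \<in> nbrs E v"
      then have "{v, w} \<in> S L" by (intro inS) (auto simp: nbrs_def)
      then show "w \<in> L" by (auto simp: S_def doubleton_eq_iff)
    next
      fix w assume "w \<in> L"
      then show "w \<in> nbrs E v" using SE by (auto simp: S_def nbrs_def)
    qed
    moreover have "nbrs E w = {v}" if w: "w \<in> L" for w
    proof (intro equalityI subsetI)
      fix x assume "x \<in> nbrs E w"
      then have "{w, x} \<in> S L" using w by (intro inS) (auto simp: nbrs_def)
      then show "x \<in> {v}" using vL(1)[OF L] w by (auto simp: S_def doubleton_eq_iff)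
    next
      fix x assume "x \<in> {v}"
      then show "x \<in> nbrs E w" using SE w by (auto simp: S_def nbrs_def insert_commute)
    qed
    ultimately show ?thesis by blast
  qed
  have disj: "disjoint_family_on ev LL"
    unfolding disjoint_family_on_def using nb by blast
  have sub: "(\<Union>L\<in>LL. ev L) \<subseteq> {E. E \<subseteq> ?V \<and> star_at m E v}"
    using nb vL by (fastforce simp: star_at_def ev_def)
  have pr: "measure_pmf.prob ?M (ev L) \<ge> a ^ m * (1 - a) ^ ((m + 1) * n)" if L: "L \<in> LL" for L
  proof -
    have TV: "T L \<subseteq> ?V" and dST: "S L \<inter> T L = {}" by (auto simp: T_def)
    have "measure_pmf.prob ?M (ev L) = measure_pmf.prob ?M {E. S L \<subseteq> E \<and> T L \<inter> E = {}}"
      unfolding ev_def using set_erdos_renyi[of _ n a]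
      by (intro measure_pmf.finite_measure_eq_AE) (auto simp: AE_measure_pmf_iff)
    also have "\<dots> = a ^ card (S L) * (1 - a) ^ card (T L)"
      by (rule prob_erdos_renyi[OF a SV[OF L] TV dST])
    also have "card (S L) = m"
    proof -
      have "inj_on (\<lambda>w. {v, w}) L" by (auto simp: inj_on_def doubleton_eq_iff)
      then show ?thesis using vL(4)[OF L] by (simp add: S_def card_image)
    qed
    finally have eq: "measure_pmf.prob ?M (ev L) = a ^ m * (1 - a) ^ card (T L)" .
    \<comment> \<open>Every forbidden pair has an endpoint among the m + 1 star vertices.
      Overcounting is harmless, as \<open>1 - a\<close> is at most 1.\<close>
    have "T L \<subseteq> (\<lambda>(x, y). {x, y}) ` (insert v L \<times> {1..n})"
    proof
      fix e assume "e \<in> T L"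
      then obtain x where x: "x \<in> e" "x \<in> insert v L" and e: "e \<subseteq> {1..n}" "card e = 2"
        by (auto simp: T_def vertex_pairs_def)
      have "\<exists>y. e = {x, y}"
        using e(2) x(1) by (auto simp: card_2_iff insert_commute)
      then obtain y where y: "e = {x, y}" ..
      then have "(x, y) \<in> insert v L \<times> {1..n}" using x(2) e(1) by auto
      then show "e \<in> (\<lambda>(x, y). {x, y}) ` (insert v L \<times> {1..n})"
        unfolding y by (rule rev_image_eqI) simp
    qed
    then have "card (T L) \<le> card (insert v L \<times> {1..n})"
      using vL(3)[OF L] by (intro surj_card_le) auto
    also have "\<dots> = (m + 1) * n"
      using vL[OF L] by (simp add: card_cartesian_product)
    finally have "(1 - a) ^ ((m + 1) * n) \<le> (1 - a) ^ card (T L)"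
      using a by (intro power_decreasing) auto
    then show ?thesis unfolding eq using a by (intro mult_left_mono) auto
  qed
  have "((n - 1) choose m) * a ^ m * (1 - a) ^ ((m + 1) * n)
      = (\<Sum>L\<in>LL. a ^ m * (1 - a) ^ ((m + 1) * n))"
    by (simp add: cLL)
  also have "\<dots> \<le> (\<Sum>L\<in>LL. measure_pmf.prob ?M (ev L))"
    by (intro sum_mono pr)
  also have "\<dots> = measure_pmf.prob ?M (\<Union>L\<in>LL. ev L)"
    by (intro measure_pmf.finite_measure_finite_Union[symmetric] finLL disj) auto
  also have "\<dots> \<le> measure_pmf.prob ?M {E. E \<subseteq> ?V \<and> star_at m E v}"
    by (intro measure_pmf.finite_measure_mono sub) auto
  finally show ?thesis .
qed

text \<open>A crude positive bound uniform in n: the first factor comes from the binomial estimate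
  with n - 1 >= n/2, the second from \<open>(1 - p / n) ^ n\<close> exceeding half its limit exp(-p)
  eventually.\<close>

definition star_density :: "real \<Rightarrow> nat \<Rightarrow> real" where
  "star_density p m = (p / (2 * m)) ^ m * (exp (- p) / 2) ^ (m + 1)"

lemma eventually_prob_star_ge:
  assumes p: "p > 0" and m: "m \<ge> 1"
  shows "\<forall>\<^sub>F n in sequentially. \<forall>v\<in>{1..n}.
     measure_pmf.prob (erdos_renyi n (p / n)) {E. E \<subseteq> vertex_pairs n \<and> star_at m E v} \<ge> star_density p m"
proof -
  have "(\<lambda>n. (1 + (- p) / real n) ^ n) \<longlonglongrightarrow> exp (- p)" by (rule tendsto_exp_limit_sequentially)
  moreover have "exp (- p) / 2 < exp (- p)" by simp
  ultimately have "\<forall>\<^sub>F n in sequentially. exp (- p) / 2 < (1 + (- p) / real n) ^ n"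
    by (rule order_tendstoD)
  moreover have "\<forall>\<^sub>F n in sequentially. n \<ge> nat \<lceil>p\<rceil> + m + 2" by (rule eventually_ge_at_top)
  ultimately show ?thesis
  proof eventually_elim
    case (elim n)
    have n: "real n \<ge> p" "m \<le> n - 1" "n \<ge> 2" "real n > 0" using elim(2) p by linarith+
    have a: "0 \<le> p / n" "p / n \<le> 1" using p n by auto
    show ?case
    proof
      fix v assume v: "v \<in> {1..n}"
      have "(p / (2 * m)) ^ m = (real n / 2 / m) ^ m * (p / n) ^ m"
        unfolding power_mult_distrib[symmetric] using n m by (simp add: field_simps)
      also have "\<dots> \<le> (real (n - 1) / m) ^ m * (p / n) ^ m"
        using n m a by (intro mult_right_mono power_mono divide_right_mono) auto
      also have "\<dots> \<le> real ((n - 1) choose m) * (p / n) ^ m"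
        using binomial_ge_n_over_k_pow_k[OF n(2), where 'a = real] a by (intro mult_right_mono) auto
      finally have 1: "(p / (2 * m)) ^ m \<le> real ((n - 1) choose m) * (p / n) ^ m" .
      have "(exp (- p) / 2) ^ (m + 1) \<le> ((1 - p / n) ^ n) ^ (m + 1)"
        using elim(1) by (intro power_mono) auto
      also have "\<dots> = (1 - p / n) ^ ((m + 1) * n)"
        by (simp only: power_mult[symmetric] mult.commute)
      finally have "star_density p m
          \<le> real ((n - 1) choose m) * (p / n) ^ m * (1 - p / n) ^ ((m + 1) * n)"
        unfolding star_density_def using 1 a p by (intro mult_mono) auto
      also have "\<dots> \<le> measure_pmf.prob (erdos_renyi n (p / n)) {E. E \<subseteq> vertex_pairs n \<and> star_at m E v}"
        by (rule prob_star_ge[OF a v])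
      finally show "measure_pmf.prob (erdos_renyi n (p / n)) {E. E \<subseteq> vertex_pairs n \<and> star_at m E v}
        \<ge> star_density p m" .
    qed
  qed
qed

subsection \<open>The edge of the limiting spectrum\<close>

lemma expectation_affine_indicator:
  fixes M :: "'a pmf" and a b :: real
  shows "integrable M (\<lambda>\<omega>. a + b * indicator S \<omega>)"
    and "measure_pmf.expectation M (\<lambda>\<omega>. a + b * indicator S \<omega>) = a + b * measure_pmf.prob M S"
proof -
  have i: "integrable M (\<lambda>\<omega>. b * indicator S \<omega>)"
    by (auto simp: measure_pmf.emeasure_finite less_top[symmetric])
  then show "integrable M (\<lambda>\<omega>. a + b * indicator S \<omega>)" by auto
  show "measure_pmf.expectation M (\<lambda>\<omega>. a + b * indicator S \<omega>) = a + b * measure_pmf.prob M S"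
    using i by (subst Bochner_Integration.integral_add) auto
qed

lemma expectation_tendsto_of_tendsto_in_prob:
  fixes M :: "nat \<Rightarrow> 'a pmf" and X :: "nat \<Rightarrow> 'a \<Rightarrow> real"
  assumes bd: "\<And>n \<omega>. \<bar>X n \<omega>\<bar> \<le> B"
    and lim: "\<And>\<epsilon>. \<epsilon> > 0 \<Longrightarrow> (\<lambda>n. measure_pmf.prob (M n) {\<omega>. \<bar>X n \<omega> - I\<bar> > \<epsilon>}) \<longlonglongrightarrow> 0"
  shows "(\<lambda>n. measure_pmf.expectation (M n) (X n)) \<longlonglongrightarrow> I"
proof (rule tendstoI)
  fix e :: real assume e: "e > 0"
  \<comment> \<open>\<open>B + \<bar>I\<bar>\<close> bounds the deviation on the bad event; adding 1
    makes \<open>D\<close> strictly positive, so that dividing by it is safe.\<close>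
  define D where "D = B + \<bar>I\<bar> + 1"
  have B: "B \<ge> 0" using bd[of 0 undefined] by linarith
  then have D: "D > 0" by (simp add: D_def)
  have "\<forall>\<^sub>F n in sequentially. measure_pmf.prob (M n) {\<omega>. \<bar>X n \<omega> - I\<bar> > e / 2} < e / (2 * D)"
    using e D by (intro order_tendstoD(2)[OF lim]) auto
  then show "\<forall>\<^sub>F n in sequentially. dist (measure_pmf.expectation (M n) (X n)) I < e"
  proof eventually_elim
    case (elim n)
    let ?A = "{\<omega>. \<bar>X n \<omega> - I\<bar> > e / 2}"
    have iX: "integrable (M n) (X n)"
      using bd by (intro measure_pmf.integrable_const_bound[of _ B]) auto
    have "\<bar>measure_pmf.expectation (M n) (X n) - I\<bar> = \<bar>measure_pmf.expectation (M n) (\<lambda>\<omega>. X n \<omega> - I)\<bar>"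
      using iX by simp
    also have "\<dots> \<le> measure_pmf.expectation (M n) (\<lambda>\<omega>. \<bar>X n \<omega> - I\<bar>)"
      by (rule integral_abs_bound)
    also have "\<dots> \<le> measure_pmf.expectation (M n) (\<lambda>\<omega>. e / 2 + D * indicator ?A \<omega>)"
    proof (rule integral_mono)
      fix \<omega>
      show "\<bar>X n \<omega> - I\<bar> \<le> e / 2 + D * indicator ?A \<omega>"
        using bd[of n \<omega>] e by (auto simp: D_def indicator_def)
    qed (use iX expectation_affine_indicator(1) in auto)
    also have "\<dots> = e / 2 + D * measure_pmf.prob (M n) ?A"
      by (rule expectation_affine_indicator(2))
    also have "\<dots> < e / 2 + D * (e / (2 * D))"
      using elim D by (intro add_strict_left_mono mult_strict_left_mono) auto
    also have "\<dots> = e" using D by simp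
    finally show ?case by (simp add: dist_real_def)
  qed
qed

lemma test_fun_nonneg: "test_fun k x \<ge> 0"
  and test_fun_le: "test_fun k x \<le> 3 ^ k"
  unfolding test_fun_def by (auto intro!: power_mono)

lemma test_fun_mono: "x \<le> y \<Longrightarrow> test_fun k x \<le> test_fun k y"
  unfolding test_fun_def by (intro power_mono) auto

lemma continuous_test_fun: "continuous_on UNIV (test_fun k)"
  unfolding test_fun_def[abs_def] by (intro continuous_intros)

lemma integrable_test_fun:
  assumes "real_distribution \<mu>"
  shows "integrable \<mu> (test_fun k)"
proof -
  interpret real_distribution \<mu> by fact
  have "test_fun k \<in> borel_measurable borel"
    using continuous_test_fun by (rule borel_measurable_continuous_onI)
  then show ?thesis
    using test_fun_nonneg[of k] test_fun_le[of k]
    by (intro integrable_const_bound[of _ "3 ^ k"]) auto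
qed

lemma expectation_esd_tendsto:
  assumes conv: "weak_conv_in_prob (\<lambda>n. measure_pmf (M n)) (\<lambda>n E. esd (Y n E)) \<mu>"
  shows "(\<lambda>n. measure_pmf.expectation (M n) (\<lambda>E. \<integral>x. test_fun k x \<partial>esd (Y n E)))
           \<longlonglongrightarrow> (\<integral>x. test_fun k x \<partial>\<mu>)"
proof (rule expectation_tendsto_of_tendsto_in_prob[where B = "3 ^ k"])
  have bd: "bounded (range (test_fun k))"
    using test_fun_nonneg[of k] test_fun_le[of k] by (intro boundedI[of _ "3 ^ k"]) auto
  show "(\<lambda>n. measure_pmf.prob (M n)
      {E. \<bar>(\<integral>x. test_fun k x \<partial>esd (Y n E)) - (\<integral>x. test_fun k x \<partial>\<mu>)\<bar> > \<epsilon>}) \<longlonglongrightarrow> 0"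
    if "\<epsilon> > 0" for \<epsilon>
    using conv continuous_test_fun[of k] bd that unfolding weak_conv_in_prob_def by simp
  show "\<bar>\<integral>x. test_fun k x \<partial>esd (Y n E)\<bar> \<le> 3 ^ k" for n E
  proof -
    have i: "integrable (esd (Y n E)) (test_fun k)"
      unfolding esd_def using test_fun_nonneg[of k] test_fun_le[of k]
      by (intro measure_pmf.integrable_const_bound[of _ "3 ^ k"]) auto
    have "(\<integral>x. test_fun k x \<partial>esd (Y n E)) \<le> (\<integral>x. 3 ^ k \<partial>esd (Y n E))"
      using i test_fun_le by (intro integral_mono) (auto simp: esd_def)
    also have "\<dots> = 3 ^ k" by (simp add: esd_def)
    finally show ?thesis using test_fun_nonneg[of k] by (simp add: abs_le_iff)
  qed
qed

lemma expectation_average_indicator: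
  fixes M :: "'a pmf" and a b :: real
  shows "measure_pmf.expectation M (\<lambda>E. (\<Sum>v\<in>{1..n}. a + b * indicator (S v) E) / real n)
    = (\<Sum>v\<in>{1..n}. a + b * measure_pmf.prob M (S v)) / real n"
    and "integrable M (\<lambda>E. (\<Sum>v\<in>{1..n}. a + b * indicator (S v) E) / real n)"
proof -
  note i = expectation_affine_indicator(1)[of M a b]
  show "measure_pmf.expectation M (\<lambda>E. (\<Sum>v\<in>{1..n}. a + b * indicator (S v) E) / real n)
    = (\<Sum>v\<in>{1..n}. a + b * measure_pmf.prob M (S v)) / real n"
    unfolding Bochner_Integration.integral_divide_zero
    by (subst Bochner_Integration.integral_sum) (rule i, simp only: expectation_affine_indicator(2))
  show "integrable M (\<lambda>E. (\<Sum>v\<in>{1..n}. a + b * indicator (S v) E) / real n)"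
    by (intro integrable_divide_zero Bochner_Integration.integrable_sum i)
qed

section \<open>Two-sided bounds on the test integrals of the limit\<close>

context
  fixes c p :: real and \<mu> :: "real measure"
  assumes c: "c \<ge> 0" and p: "p > 0"
    and conv: "weak_conv_in_prob (\<lambda>n. measure_pmf (erdos_renyi n (p / real n)))
           (\<lambda>n E. esd (walk_mat c n E)) \<mu>"
begin

private lemma integrable_integral_esd:
  "integrable (erdos_renyi n a) (\<lambda>E. \<integral>x. test_fun k x \<partial>esd (walk_mat c n E))"
proof (rule integrable_measure_pmf_finite)
  show "finite (set_pmf (erdos_renyi n a))"
    by (rule finite_subset[of _ "Pow (vertex_pairs n)"])
      (use set_erdos_renyi finite_vertex_pairs in auto)
qed

text \<open>Sparse vertices return at most \<open>(1 + tau c) ^ k\<close>, the others at most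
  \<open>2 ^ k\<close>. For fixed k the latter contribute O(1/n) in expectation and disappear in the
  limit, leaving no constant factor.\<close>

lemma integral_test_fun_le: "(\<integral>x. test_fun k x \<partial>\<mu>) \<le> (1 + tau c) ^ k"
proof -
  let ?L = "2 * k + 3"
  define C where "C = (\<Sum>m\<in>{1..?L}. 2 ^ 2 ^ m * p ^ m)"
  let ?M = "\<lambda>n. erdos_renyi n (p / real n)"
  let ?S = "\<lambda>n v. {E. E \<subseteq> vertex_pairs n \<and> \<not> sparse_at ?L E v}"
  have "(\<lambda>n. (1 + tau c) ^ k + 2 ^ k * (C / real n)) \<longlonglongrightarrow> (1 + tau c) ^ k + 2 ^ k * 0"
    by (intro tendsto_intros lim_const_over_n)
  moreover have "\<forall>\<^sub>F n in sequentially.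
      measure_pmf.expectation (?M n) (\<lambda>E. \<integral>x. test_fun k x \<partial>esd (walk_mat c n E))
        \<le> (1 + tau c) ^ k + 2 ^ k * (C / real n)"
    using eventually_ge_at_top[of "nat \<lceil>p\<rceil> + 1"]
  proof eventually_elim
    case (elim n)
    then have n: "p \<le> real n" "n > 0" by linarith+
    have "measure_pmf.expectation (?M n) (\<lambda>E. \<integral>x. test_fun k x \<partial>esd (walk_mat c n E))
        \<le> measure_pmf.expectation (?M n)
            (\<lambda>E. (\<Sum>v\<in>{1..n}. (1 + tau c) ^ k + 2 ^ k * indicator (?S n v) E) / real n)"
    proof (rule integral_mono_AE[OF integrable_integral_esd expectation_average_indicator(2)])
      show "AE E in ?M n. (\<integral>x. test_fun k x \<partial>esd (walk_mat c n E))
          \<le> (\<Sum>v\<in>{1..n}. (1 + tau c) ^ k + 2 ^ k * indicator (?S n v) E) / real n"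
        unfolding AE_measure_pmf_iff
      proof
        fix E assume "E \<in> set_pmf (?M n)"
        then have E: "E \<subseteq> vertex_pairs n" by (rule set_erdos_renyi)
        have E2: "card e = 2" if "e \<in> E" for e using E that by (auto simp: vertex_pairs_def)
        have "(lazy_step c E ^^ k) (\<lambda>w. if w = v then 1 else 0) v
            \<le> (1 + tau c) ^ k + 2 ^ k * indicator (?S n v) E" for v
        proof (cases "sparse_at ?L E v")
          case True
          then show ?thesis
            using lazy_return_sparse_le[OF c True E2 nbrs_vertex_pairs(2)[OF E]] by simp
        next
          case False
          have "(lazy_step c E ^^ k) (\<lambda>w. if w = v then 1 else 0) v \<le> 2 ^ k"
            by (rule funpow_lazy_step_le_2_power[OF c]) auto
          then show ?thesis using False E tau_pos[OF c] by (simp add: add_increasing)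
        qed
        then show "(\<integral>x. test_fun k x \<partial>esd (walk_mat c n E))
            \<le> (\<Sum>v\<in>{1..n}. (1 + tau c) ^ k + 2 ^ k * indicator (?S n v) E) / real n"
          unfolding integral_esd_walk_mat[OF c E n(2)] by (intro divide_right_mono sum_mono) auto
      qed
    qed
    also have "\<dots> = (\<Sum>v\<in>{1..n}. (1 + tau c) ^ k + 2 ^ k * measure_pmf.prob (?M n) (?S n v)) / real n"
      by (rule expectation_average_indicator)
    also have "\<dots> \<le> (\<Sum>v\<in>{1..n}. (1 + tau c) ^ k + 2 ^ k * (C / real n)) / real n"
    proof (intro divide_right_mono sum_mono add_left_mono mult_left_mono)
      fix v assume "v \<in> {1..n}"
      then show "measure_pmf.prob (?M n) (?S n v) \<le> C / real n"
        unfolding C_def using p n by (intro prob_not_sparse_le) auto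
    qed auto
    also have "\<dots> = (1 + tau c) ^ k + 2 ^ k * (C / real n)" using n by simp
    finally show ?case .
  qed
  ultimately show ?thesis
    using tendsto_le[OF _ _ expectation_esd_tendsto[OF conv, of k]] by simp
qed

text \<open>Star centres form an expected fraction of at least \<open>star_density p m\<close> for
  large n, and all other vertices contribute nonnegatively. The density is independent of
  \<open>k\<close>, so it does not affect the growth rate.\<close>

lemma integral_test_fun_ge:
  assumes m: "m \<ge> 1"
  shows "(\<integral>x. test_fun k x \<partial>\<mu>) \<ge> star_density p m * (1 + star_eigval c m) ^ k / 2"
proof -
  let ?M = "\<lambda>n. erdos_renyi n (p / real n)" and ?b = "(1 + star_eigval c m) ^ k / 2"
  let ?S = "\<lambda>n v. {E. E \<subseteq> vertex_pairs n \<and> star_at m E v}"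
  have b: "?b \<ge> 0" using c by (simp add: star_eigval_def)
  have "\<forall>\<^sub>F n in sequentially. ?b * star_density p m
      \<le> measure_pmf.expectation (?M n) (\<lambda>E. \<integral>x. test_fun k x \<partial>esd (walk_mat c n E))"
    using eventually_prob_star_ge[OF p m] eventually_gt_at_top[of 0]
  proof eventually_elim
    case (elim n)
    have "?b * star_density p m = (\<Sum>v\<in>{1..n}. 0 + ?b * star_density p m) / real n"
      using elim(2) by simp
    also have "\<dots> \<le> (\<Sum>v\<in>{1..n}. 0 + ?b * measure_pmf.prob (?M n) (?S n v)) / real n"
      using elim b by (intro divide_right_mono sum_mono add_left_mono mult_left_mono) auto
    also have "\<dots> = measure_pmf.expectation (?M n)
        (\<lambda>E. (\<Sum>v\<in>{1..n}. 0 + ?b * indicator (?S n v) E) / real n)"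
      by (rule expectation_average_indicator(1)[symmetric])
    also have "\<dots> \<le> measure_pmf.expectation (?M n) (\<lambda>E. \<integral>x. test_fun k x \<partial>esd (walk_mat c n E))"
    proof (rule integral_mono_AE[OF expectation_average_indicator(2) integrable_integral_esd])
      show "AE E in ?M n. (\<Sum>v\<in>{1..n}. 0 + ?b * indicator (?S n v) E) / real n
          \<le> (\<integral>x. test_fun k x \<partial>esd (walk_mat c n E))"
        unfolding AE_measure_pmf_iff
      proof
        fix E assume "E \<in> set_pmf (?M n)"
        then have E: "E \<subseteq> vertex_pairs n" by (rule set_erdos_renyi)
        have "0 + ?b * indicator (?S n v) E \<le> (lazy_step c E ^^ k) (\<lambda>w. if w = v then 1 else 0) v" for v
        proof (cases "star_at m E v")
          case True
          then show ?thesis using lazy_return_star_ge[OF c m True, of k] E by simp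
        next
          case False
          have "(lazy_step c E ^^ k) (\<lambda>w. if w = v then 1 else 0) v \<ge> 0"
            by (rule funpow_lazy_step_nonneg[OF c]) simp
          then show ?thesis using False by simp
        qed
        then show "(\<Sum>v\<in>{1..n}. 0 + ?b * indicator (?S n v) E) / real n
            \<le> (\<integral>x. test_fun k x \<partial>esd (walk_mat c n E))"
          unfolding integral_esd_walk_mat[OF c E elim(2)] by (intro divide_right_mono sum_mono) auto
      qed
    qed
    finally show ?case .
  qed
  then have "?b * star_density p m \<le> (\<integral>x. test_fun k x \<partial>\<mu>)"
    by (rule tendsto_lowerbound[OF expectation_esd_tendsto[OF conv]]) simp
  then show ?thesis by (simp add: mult_ac)
qed

end

text \<open>A fixed positive factor cannot compensate a larger base as k grows; this turns the
  moment bounds into bounds on the edge.\<close>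

lemma exponential_growth_le:
  fixes x y d :: real
  assumes "d > 0" "x > 0" "\<And>k :: nat. d * y ^ k \<le> x ^ k"
  shows "y \<le> x"
proof (rule ccontr)
  assume "\<not> y \<le> x"
  then have "1 < y / x" using assms(2) by simp
  then obtain k where k: "1 / d < (y / x) ^ k" using real_arch_pow by blast
  then have "x ^ k < d * y ^ k" using assms(1,2) by (simp add: power_divide field_simps)
  with assms(3)[of k] show False by simp
qed

theorem theorem6:
  fixes c p :: real and \<mu> :: "real measure"
  assumes "c \<ge> 0" and "p > 0"
    and "real_distribution \<mu>"
    and "weak_conv_in_prob (\<lambda>n. measure_pmf (erdos_renyi n (p / real n)))
           (\<lambda>n E. esd (walk_mat c n E)) \<mu>"
  shows "ess_sup \<mu> = ereal (tau c)"
proof -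
  interpret real_distribution \<mu> by fact
  note upper = integral_test_fun_le[OF assms(1,2,4)]
  note lower = integral_test_fun_ge[OF assms(1,2,4)]
  note t = tau_pos[OF assms(1)] tau_le_1[OF assms(1)]
  note int = integrable_test_fun[OF assms(3)]
  have "x \<le> tau c" if "emeasure \<mu> {x<..} > 0" for x
  proof -
    define s where "s = min 2 (max (- 1) x)"
    have pos: "prob {x<..} > 0" using that by (simp add: emeasure_eq_measure)
    have "prob {x<..} * (1 + s) ^ k \<le> (1 + tau c) ^ k" for k
    proof -
      have "prob {x<..} * (1 + s) ^ k = (\<integral>y. (1 + s) ^ k * indicator {x<..} y \<partial>\<mu>)" by simp
      also have "\<dots> \<le> (\<integral>y. test_fun k y \<partial>\<mu>)"
      proof (rule integral_mono[OF _ int])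
        fix y show "(1 + s) ^ k * indicator {x<..} y \<le> test_fun k y"
          using test_fun_mono[of x y k] test_fun_nonneg[of k y]
          by (auto simp: indicator_def s_def test_fun_def[of k x])
      qed (auto simp: emeasure_finite less_top[symmetric])
      also have "\<dots> \<le> (1 + tau c) ^ k" by (rule upper)
      finally show ?thesis .
    qed
    then have "1 + s \<le> 1 + tau c"
      by (rule exponential_growth_le[OF pos, rotated]) (use t in simp)
    \<comment> \<open>As \<open>tau c\<close> is at most 1, below the cap 2, the bound on the
      truncated value \<open>s\<close> passes to \<open>x\<close> itself.\<close>
    then show ?thesis using t by (auto simp: s_def)
  qed
  then have "ess_sup \<mu> \<le> ereal (tau c)"
    unfolding ess_sup_def by (auto intro!: Sup_least)
  moreover have "\<not> ess_sup \<mu> < ereal (tau c)"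
  proof
    assume "ess_sup \<mu> < ereal (tau c)"
    then obtain r where r: "ess_sup \<mu> < ereal r" "r < tau c" using ereal_dense2 by fastforce
    \<comment> \<open>Raising \<open>r\<close> to at least 0 keeps \<open>s\<close> below
      \<open>tau c\<close> and makes the truncation in \<open>test_fun k s\<close> inactive, while
      still no mass may lie above \<open>s\<close>.\<close>
    define s where "s = max r 0"
    have s: "0 \<le> s" "s < tau c" using r t by (auto simp: s_def)
    have "emeasure \<mu> {s<..} = 0"
    proof (rule ccontr)
      assume "emeasure \<mu> {s<..} \<noteq> 0"
      then have "ereal s \<le> ess_sup \<mu>"
        unfolding ess_sup_def by (intro Sup_upper) (auto simp: zero_less_iff_neq_zero)
      then have "ereal s < ereal r" using r(1) by (rule le_less_trans)
      then show False by (simp add: s_def)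
    qed
    then have "AE y in \<mu>. y \<notin> {s<..}" by (intro AE_not_in) (auto simp: null_sets_def)
    then have ae: "AE y in \<mu>. test_fun k y \<le> (1 + s) ^ k" for k
    proof eventually_elim
      case (elim y)
      then have "test_fun k y \<le> test_fun k s" by (intro test_fun_mono) auto
      then show ?case using s t by (simp add: test_fun_def)
    qed
    \<comment> \<open>The star size is fixed here, before the exponent varies: a single star whose
      eigenvalue exceeds \<open>s\<close> already forces growth faster than the supposed support
      allows.\<close>
    have "\<forall>\<^sub>F m in sequentially. s < star_eigval c m"
      by (rule order_tendstoD(1)[OF star_eigval_tendsto[OF assms(1)] s(2)])
    then have "\<forall>\<^sub>F m in sequentially. s < star_eigval c m \<and> m \<ge> 1"
      using eventually_ge_at_top[of 1] by (rule eventually_conj)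
    then obtain m where m: "s < star_eigval c m" "m \<ge> 1"
      by (auto simp: eventually_sequentially)
    have growth: "star_density p m / 2 * (1 + star_eigval c m) ^ k \<le> (1 + s) ^ k" for k
    proof -
      have "star_density p m / 2 * (1 + star_eigval c m) ^ k \<le> (\<integral>y. test_fun k y \<partial>\<mu>)"
        using lower[OF m(2), of k] by simp
      also have "\<dots> \<le> (\<integral>y. (1 + s) ^ k \<partial>\<mu>)" by (intro integral_mono_AE int ae) simp
      also have "\<dots> = (1 + s) ^ k" using prob_space by simp
      finally show ?thesis .
    qed
    have "star_density p m / 2 > 0" using m assms(2) by (simp add: star_density_def)
    then have "1 + star_eigval c m \<le> 1 + s"
      by (rule exponential_growth_le[OF _ _ growth]) (use s in simp)
    then show False using m by simp
  qed
  ultimately show ?thesis by (simp add: antisym_conv1)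
qed

end
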